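(* For every $(\psi, \phi) \in C^* \times C$, $$B(\psi, T(t)\phi) = B(T^*(t)\psi, \phi)$$ holds for all $t \ge 0$.
   Context: Let $r>0$ and let $n$ be a positive integer. $\mathbb{C}^n$ denotes column vectors, $(\mathbb{C}^n)'$ denotes $n$-dimensional complex row vectors, $M_n(\mathbb{C})$ the $n\times n$ complex matrices. Let $\eta=(\eta_{ij})\colon [-r,0]\to M_n(\mathbb{C})$ be a function of bounded variation. Integrals against $d\eta$ are Riemann–Stieltjes integrals taken componentwise: for continuous $\phi$ (column valued) and $\psi$ (row valued), $\left(\int d\eta(\theta)\,\phi(\theta)\right)_i=\sum_j\int \phi_j(\theta)\,d\eta_{ij}(\theta)$ and $\left(\int \psi(\theta)\,d\eta(\theta)\right)_j=\sum_i\int \psi_i(\theta)\,d\eta_{ij}(\theta)$. Write $C=C([-r,0],\mathbb{C}^n)$ and $C^*=C([0,r],(\mathbb{C}^n)')$ (supremum norms). Define the continuous linear maps $L\colon C\to\mathbb{C}^n$, $L\phi=\int_{-r}^0 d\eta(\theta)\,\phi(\theta)$, and $L^*\colon C^*\to(\mathbb{C}^n)'$, $L^*\psi=\int_{-r}^0\psi(-\theta)\,d\eta(\theta)$. The bilinear form $B\colon C^*\times C\to\mathbb{C}$ is $$B(\psi,\phi)=\psi(0)\phi(0)+\int_{-r}^0\left(\int_{-r}^{\xi}\psi(\xi-\theta)\,d\eta(\theta)\right)\phi(\xi)\,d\xi ,$$ where the inner integral, as a function of $\xi\in[-r,0]$, is Riemann integrable. For $\phi\in C$, $x(\cdot;\phi)\colon[-r,\infty)\to\mathbb{C}^n$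 is the unique continuous solution (known to exist) of $\dot x(t)=Lx_t$ $(t\ge0)$, $x_0=\phi$, where $x_t\in C$, $x_t(\theta)=x(t+\theta)$ for $\theta\in[-r,0]$. For $\psi\in C^*$, $y(\cdot;\psi)\colon(-\infty,r]\to(\mathbb{C}^n)'$ is the unique continuous solution (known to exist) of $\dot y(t)=-L^*y^t$ $(t\le0)$, $y^0=\psi$, where $y^t\in C^*$, $y^t(\tau)=y(t+\tau)$ for $\tau\in[0,r]$. (Derivatives at $t=0$ are one-sided.) For $t\ge0$ set $T(t)\phi=x(\cdot;\phi)_t$ and $T^*(t)\psi=y(\cdot;\psi)^{-t}$; $(T(t))_{t\ge0}$ and $(T^*(t))_{t\ge0}$ are $C_0$-semigroups on $C$ and $C^*$, respectively. *)

theory Defs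
  imports "HOL-Analysis.Analysis" "HOL-Library.FuncSet"
begin

text \<open>Division members \<open>K\<close> are nonempty compact intervals, so \<open>Inf K\<close> and \<open>Sup K\<close> are their end
  points.\<close>

definition bounded_variation_on :: "(real \<Rightarrow> 'a::real_normed_vector) \<Rightarrow> real \<Rightarrow> real \<Rightarrow> bool" where
  "bounded_variation_on g a b \<longleftrightarrow>
     (\<exists>M. \<forall>D. D division_of {a..b} \<longrightarrow> (\<Sum>K\<in>D. norm (g (Sup K) - g (Inf K))) \<le> M)"

text \<open>The Riemann--Stieltjes integral \<open>\<integral>\<^sub>a\<^sup>b f dg\<close>, as a limit over tagged partitions whose mesh tends to
  zero (a uniform mesh, not a Henstock--Kurzweil gauge).\<close>

definition has_rs_integral ::
    "(real \<Rightarrow> complex) \<Rightarrow> (real \<Rightarrow> complex) \<Rightarrow> real \<Rightarrow> real \<Rightarrow> complex \<Rightarrow> bool" where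
  "has_rs_integral f g a b I \<longleftrightarrow>
     (\<forall>e>0. \<exists>d>0. \<forall>p. p tagged_division_of {a..b} \<and> (\<forall>(s, K)\<in>p. Sup K - Inf K < d) \<longrightarrow>
        norm ((\<Sum>(s, K)\<in>p. f s * (g (Sup K) - g (Inf K))) - I) < e)"

definition rs_integral :: "(real \<Rightarrow> complex) \<Rightarrow> (real \<Rightarrow> complex) \<Rightarrow> real \<Rightarrow> real \<Rightarrow> complex" where
  "rs_integral f g a b = (THE I. has_rs_integral f g a b I)"

text \<open>\<open>\<integral>\<^sub>a\<^sup>b d\<eta>(\<theta>) \<phi>(\<theta>)\<close> for column-valued \<open>\<phi>\<close>, and \<open>\<integral>\<^sub>a\<^sup>b \<psi>(\<theta>) d\<eta>(\<theta>)\<close> for row-valued \<open>\<psi>\<close>. Rows and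
  columns share the type \<open>complex ^ 'n\<close>, and \<open>\<eta> \<theta> $ i $ j\<close> is the entry in row \<open>i\<close>, column \<open>j\<close>.\<close>

definition rs_integral_col ::
    "(real \<Rightarrow> complex ^ 'n ^ 'n) \<Rightarrow> (real \<Rightarrow> complex ^ 'n) \<Rightarrow> real \<Rightarrow> real \<Rightarrow> complex ^ 'n::finite" where
  "rs_integral_col \<eta> \<phi> a b =
     (\<chi> i. \<Sum>j\<in>UNIV. rs_integral (\<lambda>\<theta>. \<phi> \<theta> $ j) (\<lambda>\<theta>. \<eta> \<theta> $ i $ j) a b)"

definition rs_integral_row ::
    "(real \<Rightarrow> complex ^ 'n) \<Rightarrow> (real \<Rightarrow> complex ^ 'n ^ 'n) \<Rightarrow> real \<Rightarrow> real \<Rightarrow> complex ^ 'n::finite" where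
  "rs_integral_row \<psi> \<eta> a b =
     (\<chi> j. \<Sum>i\<in>UNIV. rs_integral (\<lambda>\<theta>. \<psi> \<theta> $ i) (\<lambda>\<theta>. \<eta> \<theta> $ i $ j) a b)"

definition C_space :: "real \<Rightarrow> (real \<Rightarrow> complex ^ 'n::finite) set" where
  "C_space r = {\<phi>. continuous_on {-r..0} \<phi>}"

definition Cstar_space :: "real \<Rightarrow> (real \<Rightarrow> complex ^ 'n::finite) set" where
  "Cstar_space r = {\<psi>. continuous_on {0..r} \<psi>}"

definition L_op ::
    "real \<Rightarrow> (real \<Rightarrow> complex ^ 'n ^ 'n) \<Rightarrow> (real \<Rightarrow> complex ^ 'n) \<Rightarrow> complex ^ 'n::finite" where
  "L_op r \<eta> \<phi> = rs_integral_col \<eta> \<phi> (-r) 0"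

definition Lstar_op ::
    "real \<Rightarrow> (real \<Rightarrow> complex ^ 'n ^ 'n) \<Rightarrow> (real \<Rightarrow> complex ^ 'n) \<Rightarrow> complex ^ 'n::finite" where
  "Lstar_op r \<eta> \<psi> = rs_integral_row (\<lambda>\<theta>. \<psi> (-\<theta>)) \<eta> (-r) 0"

text \<open>The bilinear form. \<open>scalar_product\<close> is the product of a row and a column, without complex
  conjugation (unlike \<open>inner\<close>, which is moreover real-valued).\<close>

definition B_form ::
    "real \<Rightarrow> (real \<Rightarrow> complex ^ 'n ^ 'n) \<Rightarrow> (real \<Rightarrow> complex ^ 'n) \<Rightarrow> (real \<Rightarrow> complex ^ 'n::finite)
       \<Rightarrow> complex" where
  "B_form r \<eta> \<psi> \<phi> = scalar_product (\<psi> 0) (\<phi> 0) +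
     integral {-r..0}
       (\<lambda>\<xi>. scalar_product (rs_integral_row (\<lambda>\<theta>. \<psi> (\<xi> - \<theta>)) \<eta> (-r) \<xi>) (\<phi> \<xi>))"

text \<open>The segments \<open>x\<^sub>t\<close> and \<open>y\<^sup>t\<close>.\<close>

definition segment :: "real \<Rightarrow> (real \<Rightarrow> complex ^ 'n::finite) \<Rightarrow> real \<Rightarrow> real \<Rightarrow> complex ^ 'n" where
  "segment r x t = (\<lambda>\<theta>\<in>{-r..0}. x (t + \<theta>))"

definition segment_star :: "real \<Rightarrow> (real \<Rightarrow> complex ^ 'n::finite) \<Rightarrow> real \<Rightarrow> real \<Rightarrow> complex ^ 'n" where
  "segment_star r y t = (\<lambda>\<tau>\<in>{0..r}. y (t + \<tau>))"

text \<open>Solutions are functions on \<open>[-r, \<infinity>)\<close>, respectively \<open>(-\<infinity>, r]\<close>; extensionality fixes their values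
  off these domains, so that a solution is unique as a HOL function and \<open>THE\<close> can select it.\<close>

definition is_solution ::
    "real \<Rightarrow> (real \<Rightarrow> complex ^ 'n ^ 'n) \<Rightarrow> (real \<Rightarrow> complex ^ 'n) \<Rightarrow> (real \<Rightarrow> complex ^ 'n::finite)
       \<Rightarrow> bool" where
  "is_solution r \<eta> \<phi> x \<longleftrightarrow>
     x \<in> extensional {-r..} \<and> continuous_on {-r..} x \<and>
     (\<forall>t\<ge>0. (x has_vector_derivative L_op r \<eta> (segment r x t)) (at t within {0..})) \<and>
     (\<forall>\<theta>\<in>{-r..0}. segment r x 0 \<theta> = \<phi> \<theta>)"

definition is_solution_star ::
    "real \<Rightarrow> (real \<Rightarrow> complex ^ 'n ^ 'n) \<Rightarrow> (real \<Rightarrow> complex ^ 'n) \<Rightarrow> (real \<Rightarrow> complex ^ 'n::finite)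
       \<Rightarrow> bool" where
  "is_solution_star r \<eta> \<psi> y \<longleftrightarrow>
     y \<in> extensional {..r} \<and> continuous_on {..r} y \<and>
     (\<forall>t\<le>0. (y has_vector_derivative - Lstar_op r \<eta> (segment_star r y t)) (at t within {..0})) \<and>
     (\<forall>\<tau>\<in>{0..r}. segment_star r y 0 \<tau> = \<psi> \<tau>)"

definition sol ::
    "real \<Rightarrow> (real \<Rightarrow> complex ^ 'n ^ 'n) \<Rightarrow> (real \<Rightarrow> complex ^ 'n) \<Rightarrow> real \<Rightarrow> complex ^ 'n::finite" where
  "sol r \<eta> \<phi> = (THE x. is_solution r \<eta> \<phi> x)"

definition sol_star ::
    "real \<Rightarrow> (real \<Rightarrow> complex ^ 'n ^ 'n) \<Rightarrow> (real \<Rightarrow> complex ^ 'n) \<Rightarrow> real \<Rightarrow> complex ^ 'n::finite" where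
  "sol_star r \<eta> \<psi> = (THE y. is_solution_star r \<eta> \<psi> y)"

definition T_op ::
    "real \<Rightarrow> (real \<Rightarrow> complex ^ 'n ^ 'n) \<Rightarrow> real \<Rightarrow> (real \<Rightarrow> complex ^ 'n) \<Rightarrow> real \<Rightarrow> complex ^ 'n::finite" where
  "T_op r \<eta> t \<phi> = segment r (sol r \<eta> \<phi>) t"

definition Tstar_op ::
    "real \<Rightarrow> (real \<Rightarrow> complex ^ 'n ^ 'n) \<Rightarrow> real \<Rightarrow> (real \<Rightarrow> complex ^ 'n) \<Rightarrow> real \<Rightarrow> complex ^ 'n::finite" where
  "Tstar_op r \<eta> t \<psi> = segment_star r (sol_star r \<eta> \<psi>) (-t)"

end

theory Submission
  imports Defs
begin

text \<open>
  Let \<open>x\<close> be the solution of the delay equation with initial function \<open>\<phi>\<close> and \<open>y\<close> the solution of the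
  adjoint equation with initial function \<open>\<psi>\<close>. For fixed \<open>t\<close> put \<open>Z(s) = y(s - t)\<close> and consider, for
  \<open>0 \<le> s \<le> t\<close>, the value of the bilinear form at the pair of the adjoint segment of \<open>Z\<close> and the segment
  of \<open>x\<close> at time \<open>s\<close>. At \<open>s = 0\<close> this is the form at \<open>(T\<^sup>*(t)\<psi>, \<phi>)\<close>, at \<open>s = t\<close> it is the form at
  \<open>(\<psi>, T(t)\<phi>)\<close>, so it suffices that its derivative in \<open>s\<close> vanishes
  (\<open>B_form_invariant_along_trajectories\<close>).

  The integral part of the form cannot be differentiated as it stands, because \<open>s\<close> would end up, after
  the obvious substitution, in the limit of an integral against \<open>d\<eta>\<close>, and \<open>\<eta>\<close> may jump. Exchanging the
  order of integration (\<open>convolution_exchange\<close>) rewrites it as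
  \<open>\<integral> d\<eta>(\<theta>) \<integral>\<^sub>\<theta>\<^sup>0 Z(s + \<xi> - \<theta>) x(s + \<xi>) d\<xi>\<close>, with matrix indices understood. The inner integral
  equals that of \<open>Z(u - \<theta>) x(u)\<close> over the window \<open>[s + \<theta>, s]\<close>, so its derivative is
  \<open>Z(s - \<theta>) x(s) - Z(s) x(s + \<theta>)\<close> (\<open>moving_window_derivative\<close>). Differentiating under the Stieltjes
  integral (\<open>has_vector_derivative_rs_integral\<close>) yields \<open>(L\<^sup>* Z\<^sup>s) x(s) - Z(s) (L x\<^sub>s)\<close>, and this is
  exactly minus the derivative of \<open>Z(s) x(s)\<close> given by the two equations.

  The semigroups are defined by unique description, so this computation speaks about them only once both
  initial value problems are known to be uniquely solvable. That is proved for an arbitrary bounded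
  linear functional of the history, by a contraction argument in an exponentially weighted supremum norm
  (\<open>delay_solution_exists\<close>, \<open>delay_solution_unique\<close>); reversing time and transposing \<open>\<eta>\<close> reduces the
  adjoint equation to the original one.
\<close>

section \<open>Integrators of bounded variation\<close>

text \<open>The total variation of \<open>g\<close> enters the estimates below only through a real function \<open>v\<close> whose
  increments bound those of \<open>g\<close>: sums of increments of \<open>v\<close> over a division telescope, and \<open>v\<close> is
  automatically nondecreasing on \<open>[a, b]\<close>. One and the same \<open>v\<close> serves all entries of a matrix and all cut-off
  versions of \<open>g\<close>.\<close>

definition variation_dominated ::
    "(real \<Rightarrow> 'a::real_normed_vector) \<Rightarrow> (real \<Rightarrow> real) \<Rightarrow> real \<Rightarrow> real \<Rightarrow> bool" where
  "variation_dominated g v a b \<longleftrightarrow>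
     (\<forall>x y. a \<le> x \<and> x \<le> y \<and> y \<le> b \<longrightarrow> norm (g y - g x) \<le> v y - v x)"

lemma variation_dominatedD:
  "\<lbrakk>variation_dominated g v a b; a \<le> x; x \<le> y; y \<le> b\<rbrakk> \<Longrightarrow> norm (g y - g x) \<le> v y - v x"
  by (auto simp: variation_dominated_def)

lemma variation_dominated_mono:
  "\<lbrakk>variation_dominated g v a b; a \<le> x; x \<le> y; y \<le> b\<rbrakk> \<Longrightarrow> v x \<le> v y"
  using variation_dominatedD[of g v a b x y] norm_ge_zero[of "g y - g x"] by linarith

text \<open>Freezing an integrator at its value in \<open>c\<close> turns an integral over \<open>[a, c]\<close> into one over the fixed
  interval \<open>[a, b]\<close>; this is how variable upper limits are handled.\<close>

lemma variation_dominated_cutoff: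
  assumes "variation_dominated g v a b" and "a \<le> c"
  shows "variation_dominated (\<lambda>\<theta>. g (min c \<theta>)) (\<lambda>\<theta>. v (min c \<theta>)) a b"
  unfolding variation_dominated_def
proof (intro allI impI)
  fix x y assume "a \<le> x \<and> x \<le> y \<and> y \<le> b"
  then show "norm (g (min c y) - g (min c x)) \<le> v (min c y) - v (min c x)"
    using assms by (intro variation_dominatedD[OF assms(1)]) auto
qed

lemma variation_dominated_nth:
  "variation_dominated g v a b \<Longrightarrow> variation_dominated (\<lambda>\<theta>. g \<theta> $ i) v a b"
  unfolding variation_dominated_def
  by (metis Finite_Cartesian_Product.norm_nth_le order_trans vector_minus_component)

lemma division_of_append_interval:
  fixes D :: "real set set"
  assumes D: "D division_of {a..x}" and ax: "a \<le> x" and xy: "x < y"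
  shows "insert {x..y} D division_of {a..y}" "{x..y} \<notin> D" "finite D"
proof -
  show fin: "finite D"
    using D by blast
  have sub: "K \<subseteq> {a..x}" if "K \<in> D" for K
    using D that by blast
  show nin: "{x..y} \<notin> D"
    using sub[of "{x..y}"] xy by auto
  have "{{x..y}} division_of {x..y}"
    using division_of_self[of x y] xy by (simp add: box_real)
  moreover have "interior {a..x} \<inter> interior {x..y} = {}"
    by (auto simp: interior_atLeastAtMost_real)
  ultimately have "D \<union> {{x..y}} division_of {a..x} \<union> {x..y}"
    using D by (intro division_disjoint_union) auto
  moreover have "{a..x} \<union> {x..y} = {a..y}"
    using ax xy by auto
  ultimately show "insert {x..y} D division_of {a..y}"
    by simp
qed

text \<open>The dominating function is the variation function
  \<open>V x = sup \<Sum>\<^sub>K \<parallel>g (sup K) - g (inf K)\<parallel>\<close> over divisions of \<open>[a, x]\<close>: adjoining the interval \<open>[x, y]\<close> to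
  a division of \<open>[a, x]\<close> gives one of \<open>[a, y]\<close>, so \<open>V y\<close> exceeds \<open>V x\<close> by at least
  \<open>\<parallel>g y - g x\<parallel>\<close>.\<close>

lemma bounded_variation_dominated:
  fixes g :: "real \<Rightarrow> 'a::real_normed_vector"
  assumes "bounded_variation_on g a b"
  obtains v where "variation_dominated g v a b"
proof -
  let ?S = "\<lambda>D. \<Sum>K\<in>D. norm (g (Sup K) - g (Inf K))"
  obtain M where M: "\<And>D. D division_of {a..b} \<Longrightarrow> ?S D \<le> M"
    using assms unfolding bounded_variation_on_def by blast
  have step: "insert {x..y} D division_of {a..y} \<and> ?S (insert {x..y} D) = norm (g y - g x) + ?S D"
    if "D division_of {a..x}" "a \<le> x" "x < y" for D x y
    using division_of_append_interval[OF that] that by simp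
  have bounded: "?S D \<le> M" if D: "D division_of {a..x}" and "a \<le> x" "x \<le> b" for D x
  proof (cases "x = b")
    case False
    then have "?S D \<le> norm (g b - g x) + ?S D" "x < b"
      using that by auto
    moreover have "norm (g b - g x) + ?S D \<le> M"
      using step[OF D \<open>a \<le> x\<close> \<open>x < b\<close>] M[of "insert {x..b} D"] by simp
    ultimately show ?thesis by linarith
  qed (use M D in auto)
  define V where "V x = (SUP D\<in>{D. D division_of {a..x}}. ?S D)" for x
  have "norm (g y - g x) \<le> V y - V x" if "a \<le> x" "x \<le> y" "y \<le> b" for x y
  proof (cases "x = y")
    case False
    have ne: "{D. D division_of {a..x}} \<noteq> {}"
      using division_of_self[of a x] that by (auto simp: box_real)
    have bdd: "bdd_above (?S ` {D. D division_of {a..y}})"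
      using bounded[of _ y] that by (intro bdd_aboveI2[of _ _ M]) auto
    have "V x \<le> V y - norm (g y - g x)"
      unfolding V_def[of x]
    proof (rule cSUP_least[OF ne])
      fix D assume "D \<in> {D. D division_of {a..x}}"
      with False that step[of D x y]
      have "insert {x..y} D division_of {a..y}"
        "?S (insert {x..y} D) = norm (g y - g x) + ?S D" by auto
      with cSUP_upper[OF _ bdd, of "insert {x..y} D"]
      show "?S D \<le> V y - norm (g y - g x)"
        unfolding V_def by simp
    qed
    then show ?thesis by simp
  qed auto
  then show thesis
    by (intro that[of V]) (auto simp: variation_dominated_def)
qed

section \<open>The Riemann--Stieltjes integral\<close>

definition stieltjes_sum ::
    "(real \<Rightarrow> complex) \<Rightarrow> (real \<Rightarrow> complex) \<Rightarrow> (real \<times> real set) set \<Rightarrow> complex" where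
  "stieltjes_sum f g p = (\<Sum>(s, K)\<in>p. f s * (g (Sup K) - g (Inf K)))"

definition mesh_below :: "real \<Rightarrow> (real \<times> real set) set \<Rightarrow> bool" where
  "mesh_below d p \<longleftrightarrow> (\<forall>(s, K)\<in>p. Sup K - Inf K < d)"

lemma mesh_belowD: "\<lbrakk>mesh_below d p; (s, K) \<in> p\<rbrakk> \<Longrightarrow> Sup K - Inf K < d"
  by (auto simp: mesh_below_def)

lemma mesh_below_mono: "\<lbrakk>mesh_below d p; d \<le> d'\<rbrakk> \<Longrightarrow> mesh_below d' p"
  by (fastforce simp: mesh_below_def)

lemma mesh_below_Un: "\<lbrakk>mesh_below d p; mesh_below d q\<rbrakk> \<Longrightarrow> mesh_below d (p \<union> q)"
  by (auto simp: mesh_below_def)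

lemma has_rs_integral_iff:
  "has_rs_integral f g a b I \<longleftrightarrow>
     (\<forall>e>0. \<exists>d>0. \<forall>p. p tagged_division_of {a..b} \<and> mesh_below d p \<longrightarrow>
        norm (stieltjes_sum f g p - I) < e)"
  by (simp add: has_rs_integral_def stieltjes_sum_def mesh_below_def)

lemma has_rs_integralE:
  assumes "has_rs_integral f g a b I" "e > 0"
  obtains d where "d > 0"
    "\<And>p. \<lbrakk>p tagged_division_of {a..b}; mesh_below d p\<rbrakk> \<Longrightarrow> norm (stieltjes_sum f g p - I) < e"
  using assms unfolding has_rs_integral_iff by meson

lemma has_rs_integralI:
  assumes "\<And>e. e > 0 \<Longrightarrow> \<exists>d>0. \<forall>p. p tagged_division_of {a..b} \<and> mesh_below d p \<longrightarrow>
        norm (stieltjes_sum f g p - I) < e"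
  shows "has_rs_integral f g a b I"
  using assms unfolding has_rs_integral_iff by blast

lemma tagged_division_of_real_cell:
  fixes a b :: real
  assumes "p tagged_division_of {a..b}" "(s, K) \<in> p"
  shows "K = {Inf K..Sup K}" "a \<le> Inf K" "Inf K \<le> s" "s \<le> Sup K" "Sup K \<le> b"
proof -
  obtain c d where K: "K = cbox c d" and s: "s \<in> K" and sub: "K \<subseteq> {a..b}"
    using assms by (meson tagged_division_ofD(2-4))
  then have "c \<le> d" "a \<le> c" "d \<le> b" "Inf K = c" "Sup K = d"
    by (auto simp: box_real)
  with K s show "K = {Inf K..Sup K}" "a \<le> Inf K" "Inf K \<le> s" "s \<le> Sup K" "Sup K \<le> b"
    by (auto simp: box_real)
qed

lemma tagged_division_mesh_exists:
  fixes a b d :: real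
  assumes "d > 0"
  obtains p where "p tagged_division_of {a..b}" "mesh_below d p"
proof -
  have "gauge (\<lambda>x::real. ball x (d / 2))"
    using assms by (intro gauge_ball) auto
  then obtain p where p: "p tagged_division_of {a..b}" "(\<lambda>x. ball x (d / 2)) fine p"
    by (rule fine_division_exists_real)
  have "Sup K - Inf K < d" if sK: "(s, K) \<in> p" for s K
  proof -
    have "K \<subseteq> ball s (d / 2)"
      using p(2) sK by (auto simp: fine_def)
    moreover have "Inf K \<in> K" "Sup K \<in> K"
      using tagged_division_of_real_cell[OF p(1) sK] by (metis atLeastAtMost_iff order_refl order_trans)+
    ultimately have "dist s (Inf K) < d / 2" "dist s (Sup K) < d / 2"
      by auto
    then show ?thesis
      by (auto simp: dist_real_def abs_if split: if_splits)
  qed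
  with p(1) show thesis
    by (intro that) (auto simp: mesh_below_def)
qed

text \<open>The nearest point projection of the line onto the compact interval \<open>K\<close>. The increment of
  \<open>g \<circ> clamp_to K\<close> over \<open>L\<close> is the increment of \<open>g\<close> over \<open>K \<inter> L\<close>, and zero if \<open>K\<close> and \<open>L\<close> are
  disjoint. Telescoping this function over a division therefore plays the role of a common refinement,
  without forming the intersections of cells.\<close>

definition clamp_to :: "real set \<Rightarrow> real \<Rightarrow> real" where
  "clamp_to K x = max (Inf K) (min (Sup K) x)"

lemma increment_refine:
  fixes g :: "real \<Rightarrow> 'a::real_normed_vector"
  assumes p: "p tagged_division_of {a..b}" and q: "q tagged_division_of {a..b}" and ab: "a \<le> b"
    and sK: "(s, K) \<in> p"
  shows "g (Sup K) - g (Inf K) =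
    (\<Sum>(t, L)\<in>q. g (clamp_to K (Sup L)) - g (clamp_to K (Inf L)))"
proof -
  note K = tagged_division_of_real_cell[OF p sK]
  have "clamp_to K b = Sup K" "clamp_to K a = Inf K"
    using K by (auto simp: clamp_to_def)
  with additive_tagged_division_1[OF ab q, of "\<lambda>x. g (clamp_to K x)"] show ?thesis
    by simp
qed

text \<open>The Cauchy criterion. Both sums are rewritten as double sums over pairs of cells; a pair contributes
  only if its cells meet, and then the two tags are less than \<open>2 * d\<close> apart.\<close>

lemma stieltjes_sum_diff_le:
  assumes p: "p tagged_division_of {a..b}" and q: "q tagged_division_of {a..b}" and ab: "a \<le> b"
    and mp: "mesh_below d p" and mq: "mesh_below d q"
    and osc: "\<And>s t. \<lbrakk>s \<in> {a..b}; t \<in> {a..b}; \<bar>s - t\<bar> < 2 * d\<rbrakk> \<Longrightarrow> norm (f s - f t) \<le> e"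
    and g: "variation_dominated g v a b"
  shows "norm (stieltjes_sum f g p - stieltjes_sum f g q) \<le> e * (v b - v a)"
proof -
  let ?D = "\<lambda>g::real \<Rightarrow> complex. \<lambda>K L. g (clamp_to K (Sup L)) - g (clamp_to K (Inf L))"
  let ?E = "\<lambda>K L. v (clamp_to K (Sup L)) - v (clamp_to K (Inf L))"
  have P: "stieltjes_sum f g p = (\<Sum>(s, K)\<in>p. \<Sum>(t, L)\<in>q. f s * ?D g K L)"
    unfolding stieltjes_sum_def
  proof (intro sum.cong refl, clarify)
    fix s K assume "(s, K) \<in> p"
    then show "f s * (g (Sup K) - g (Inf K)) = (\<Sum>(t, L)\<in>q. f s * ?D g K L)"
      by (subst increment_refine[OF p q ab]) (auto simp: sum_distrib_left case_prod_unfold)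
  qed
  have "stieltjes_sum f g q = (\<Sum>(t, L)\<in>q. \<Sum>(s, K)\<in>p. f t * ?D g L K)"
    unfolding stieltjes_sum_def
  proof (intro sum.cong refl, clarify)
    fix t L assume "(t, L) \<in> q"
    then show "f t * (g (Sup L) - g (Inf L)) = (\<Sum>(s, K)\<in>p. f t * ?D g L K)"
      by (subst increment_refine[OF q p ab]) (auto simp: sum_distrib_left case_prod_unfold)
  qed
  then have Q: "stieltjes_sum f g q = (\<Sum>(s, K)\<in>p. \<Sum>(t, L)\<in>q. f t * ?D g L K)"
    by (simp add: case_prod_unfold sum.swap[of _ p q])
  have cell: "norm (f s * ?D g K L - f t * ?D g L K) \<le> e * ?E K L"
    if sK: "(s, K) \<in> p" and tL: "(t, L) \<in> q" for s K t L
  proof -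
    note K = tagged_division_of_real_cell[OF p sK] and L = tagged_division_of_real_cell[OF q tL]
    show ?thesis
    proof (cases "Sup K < Inf L \<or> Sup L < Inf K")
      case True
      then have "clamp_to K (Sup L) = clamp_to K (Inf L)" "clamp_to L (Sup K) = clamp_to L (Inf K)"
        using K L by (auto simp: clamp_to_def)
      then show ?thesis by simp
    next
      case False
      then have "clamp_to K (Sup L) = clamp_to L (Sup K)" "clamp_to K (Inf L) = clamp_to L (Inf K)"
        using K L by (auto simp: clamp_to_def)
      then have eq: "f s * ?D g K L - f t * ?D g L K = (f s - f t) * ?D g K L"
        by (simp add: algebra_simps)
      have "Sup K - Inf K < d" "Sup L - Inf L < d"
        using mp mq sK tL by (auto dest: mesh_belowD)
      then have "norm (f s - f t) \<le> e"
        using K L False by (intro osc) auto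
      moreover have "norm (?D g K L) \<le> ?E K L"
        using K L by (intro variation_dominatedD[OF g]) (auto simp: clamp_to_def)
      ultimately show ?thesis
        unfolding eq norm_mult
        by (intro mult_mono) (auto intro: order_trans[OF norm_ge_zero])
    qed
  qed
  have "stieltjes_sum f g p - stieltjes_sum f g q =
      (\<Sum>(s, K)\<in>p. \<Sum>(t, L)\<in>q. f s * ?D g K L - f t * ?D g L K)"
    unfolding P Q by (simp add: case_prod_unfold sum_subtractf)
  also have "norm \<dots> \<le> (\<Sum>(s, K)\<in>p. \<Sum>(t, L)\<in>q. e * ?E K L)"
    by (auto simp: case_prod_unfold intro!: sum_norm_le cell)
  also have "\<dots> = (\<Sum>(s, K)\<in>p. e * (v (Sup K) - v (Inf K)))"
  proof (intro sum.cong refl, clarify)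
    fix s K assume "(s, K) \<in> p"
    then show "(\<Sum>(t, L)\<in>q. e * ?E K L) = e * (v (Sup K) - v (Inf K))"
      by (subst increment_refine[OF p q ab, of _ K v]) (auto simp: sum_distrib_left case_prod_unfold)
  qed
  also have "\<dots> = e * (v b - v a)"
    using additive_tagged_division_1[OF ab p, of v]
    by (simp add: sum_distrib_left[symmetric] case_prod_unfold)
  finally show ?thesis .
qed

text \<open>Sequences of divisions whose mesh tends to zero turn statements about the mesh limit into statements
  about limits of sequences, to which uniqueness and preservation of inequalities apply.\<close>

definition refining_sequence :: "(nat \<Rightarrow> (real \<times> real set) set) \<Rightarrow> real \<Rightarrow> real \<Rightarrow> bool" where
  "refining_sequence P a b \<longleftrightarrow>
     (\<forall>n. P n tagged_division_of {a..b}) \<and> (\<forall>d>0. \<forall>\<^sub>F n in sequentially. mesh_below d (P n))"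

lemma refining_sequence_exists: "\<exists>P. refining_sequence P a b"
proof -
  have "\<exists>q. q tagged_division_of {a..b} \<and> mesh_below (1 / real (Suc n)) q" for n
    by (rule tagged_division_mesh_exists[of "1 / real (Suc n)" a b]) auto
  then obtain P where P: "\<And>n. P n tagged_division_of {a..b} \<and> mesh_below (1 / real (Suc n)) (P n)"
    by metis
  have "\<forall>\<^sub>F n in sequentially. mesh_below d (P n)" if "d > 0" for d
  proof -
    have "\<forall>\<^sub>F n in sequentially. 1 / real (Suc n) < d"
      using order_tendstoD(2)[OF lim_inverse_n' that] by (subst eventually_sequentially_Suc)
    then show ?thesis
      by eventually_elim (use P mesh_below_mono less_imp_le in blast)
  qed
  with P show ?thesis
    unfolding refining_sequence_def by blast
qed

lemma has_rs_integral_sequence: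
  assumes "has_rs_integral f g a b I" and P: "refining_sequence P a b"
  shows "(\<lambda>n. stieltjes_sum f g (P n)) \<longlonglongrightarrow> I"
proof (rule tendstoI)
  fix e :: real assume "e > 0"
  with assms(1) obtain d where d: "d > 0"
    "\<And>q. \<lbrakk>q tagged_division_of {a..b}; mesh_below d q\<rbrakk> \<Longrightarrow> norm (stieltjes_sum f g q - I) < e"
    by (rule has_rs_integralE) blast
  then have "\<forall>\<^sub>F n in sequentially. mesh_below d (P n)"
    using P by (simp add: refining_sequence_def)
  then show "\<forall>\<^sub>F n in sequentially. dist (stieltjes_sum f g (P n)) I < e"
    by eventually_elim (use d(2) P in \<open>simp add: refining_sequence_def dist_norm\<close>)
qed

lemma has_rs_integral_unique:
  assumes "has_rs_integral f g a b I" "has_rs_integral f g a b J"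
  shows "I = J"
proof -
  obtain P where "refining_sequence P a b"
    using refining_sequence_exists by blast
  from assms[THEN has_rs_integral_sequence, OF this] show ?thesis
    by (rule LIMSEQ_unique)
qed

lemma rs_integral_eqI: "has_rs_integral f g a b I \<Longrightarrow> rs_integral f g a b = I"
  unfolding rs_integral_def by (blast intro: has_rs_integral_unique)

lemma has_rs_integral_rs_integral:
  "has_rs_integral f g a b I \<Longrightarrow> has_rs_integral f g a b (rs_integral f g a b)"
  using rs_integral_eqI by metis

lemma uniformly_continuous_modulus:
  fixes f :: "real \<Rightarrow> 'a::real_normed_vector"
  assumes "continuous_on {a..b} f" "e > 0"
  obtains d where "d > 0"
    "\<And>s t. \<lbrakk>s \<in> {a..b}; t \<in> {a..b}; \<bar>s - t\<bar> < d\<rbrakk> \<Longrightarrow> norm (f s - f t) < e"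
proof -
  have "uniformly_continuous_on {a..b} f"
    using assms(1) by (intro compact_uniformly_continuous) auto
  then obtain d where "d > 0" "\<forall>x\<in>{a..b}. \<forall>x'\<in>{a..b}. dist x' x < d \<longrightarrow> dist (f x') (f x) < e"
    using assms(2) unfolding uniformly_continuous_on_def by metis
  then show thesis
    by (intro that[of d]) (auto simp: dist_norm dist_real_def)
qed

text \<open>Existence for a continuous integrand: Stieltjes sums along a refining sequence are Cauchy, and by the
  same estimate their limit is the limit over all fine divisions.\<close>

lemma has_rs_integral_cont:
  assumes f: "continuous_on {a..b} f" and g: "variation_dominated g v a b" and ab: "a \<le> b"
  shows "has_rs_integral f g a b (rs_integral f g a b)"
proof -
  have key: "\<exists>d>0. \<forall>p q. p tagged_division_of {a..b} \<and> q tagged_division_of {a..b} \<and>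
        mesh_below d p \<and> mesh_below d q \<longrightarrow>
        norm (stieltjes_sum f g p - stieltjes_sum f g q) < e" if e: "e > 0" for e
  proof -
    have V: "0 \<le> v b - v a"
      using variation_dominated_mono[OF g order_refl ab order_refl] by simp
    define e' where "e' = e / (v b - v a + 1)"
    have e': "e' > 0" "e' * (v b - v a) < e"
      using e V by (auto simp: e'_def field_simps)
    obtain d where d: "d > 0"
      "\<And>s t. \<lbrakk>s \<in> {a..b}; t \<in> {a..b}; \<bar>s - t\<bar> < d\<rbrakk> \<Longrightarrow> norm (f s - f t) < e'"
      using uniformly_continuous_modulus[OF f e'(1)] by blast
    show ?thesis
    proof (intro exI[of _ "d / 2"] conjI allI impI; (elim conjE)?)
      fix p q assume pq: "p tagged_division_of {a..b}" "q tagged_division_of {a..b}"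
        "mesh_below (d / 2) p" "mesh_below (d / 2) q"
      have "norm (stieltjes_sum f g p - stieltjes_sum f g q) \<le> e' * (v b - v a)"
        using d(2) by (intro stieltjes_sum_diff_le[OF pq(1,2) ab pq(3,4) _ g]) (auto intro: less_imp_le)
      with e' show "norm (stieltjes_sum f g p - stieltjes_sum f g q) < e" by simp
    qed (use d in auto)
  qed
  obtain P where "refining_sequence P a b"
    using refining_sequence_exists by blast
  then have P: "\<And>n. P n tagged_division_of {a..b}"
    and small: "\<And>d. d > 0 \<Longrightarrow> \<exists>N. \<forall>n\<ge>N. mesh_below d (P n)"
    by (auto simp: refining_sequence_def eventually_sequentially)
  have "Cauchy (\<lambda>n. stieltjes_sum f g (P n))"
  proof (rule CauchyI)
    fix e :: real assume "e > 0"
    from key[OF this] small P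
    show "\<exists>M. \<forall>m\<ge>M. \<forall>n\<ge>M. norm (stieltjes_sum f g (P m) - stieltjes_sum f g (P n)) < e"
      by metis
  qed
  then obtain I where I: "(\<lambda>n. stieltjes_sum f g (P n)) \<longlonglongrightarrow> I"
    using Cauchy_convergent convergent_def by blast
  have "has_rs_integral f g a b I"
  proof (rule has_rs_integralI)
    fix e :: real assume "e > 0"
    then obtain d where d: "d > 0" "\<And>p q. \<lbrakk>p tagged_division_of {a..b}; q tagged_division_of {a..b};
        mesh_below d p; mesh_below d q\<rbrakk> \<Longrightarrow>
        norm (stieltjes_sum f g p - stieltjes_sum f g q) < e / 2"
      using key[of "e / 2"] by auto
    obtain N where N: "\<And>n. n \<ge> N \<Longrightarrow> mesh_below d (P n)"
      using small[OF d(1)] by blast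
    show "\<exists>d>0. \<forall>p. p tagged_division_of {a..b} \<and> mesh_below d p \<longrightarrow>
        norm (stieltjes_sum f g p - I) < e"
    proof (intro exI[of _ d] conjI allI impI d(1); elim conjE)
      fix p assume p: "p tagged_division_of {a..b}" "mesh_below d p"
      have "(\<lambda>n. norm (stieltjes_sum f g p - stieltjes_sum f g (P n)))
          \<longlonglongrightarrow> norm (stieltjes_sum f g p - I)"
        by (intro tendsto_intros I)
      moreover have "\<exists>N. \<forall>n\<ge>N. norm (stieltjes_sum f g p - stieltjes_sum f g (P n)) \<le> e / 2"
        using d(2)[OF p(1) P p(2) N] by (meson less_imp_le)
      ultimately have "norm (stieltjes_sum f g p - I) \<le> e / 2"
        by (rule LIMSEQ_le_const2)
      with \<open>e > 0\<close> show "norm (stieltjes_sum f g p - I) < e" by simp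
    qed
  qed
  then show ?thesis
    by (rule has_rs_integral_rs_integral)
qed

lemma has_rs_integral_cong:
  assumes "\<And>\<theta>. \<theta> \<in> {a..b} \<Longrightarrow> f \<theta> = f' \<theta>"
  shows "has_rs_integral f g a b I \<longleftrightarrow> has_rs_integral f' g a b I"
proof -
  have "stieltjes_sum f g p = stieltjes_sum f' g p" if p: "p tagged_division_of {a..b}" for p
    unfolding stieltjes_sum_def
  proof (intro sum.cong refl, clarify)
    fix s K assume "(s, K) \<in> p"
    from tagged_division_of_real_cell[OF p this] assms
    show "f s * (g (Sup K) - g (Inf K)) = f' s * (g (Sup K) - g (Inf K))" by auto
  qed
  then show ?thesis
    unfolding has_rs_integral_iff by (simp cong: conj_cong)
qed

lemma rs_integral_cong:
  assumes "\<And>\<theta>. \<theta> \<in> {a..b} \<Longrightarrow> f \<theta> = f' \<theta>"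
  shows "rs_integral f g a b = rs_integral f' g a b"
proof -
  have "has_rs_integral f g a b = has_rs_integral f' g a b"
    using has_rs_integral_cong[of a b f f', OF assms] by (intro ext) simp
  then show ?thesis
    by (simp add: rs_integral_def)
qed

lemma has_rs_integral_lincomb:
  assumes "has_rs_integral f g a b I" "has_rs_integral f' g a b J"
  shows "has_rs_integral (\<lambda>\<theta>. c * f \<theta> + c' * f' \<theta>) g a b (c * I + c' * J)"
proof (rule has_rs_integralI)
  fix e :: real assume e: "e > 0"
  let ?e = "e / (norm c + norm c' + 1)"
  have pos: "norm c + norm c' + 1 > 0"
    by (simp add: add_nonneg_pos)
  with e have "?e > 0"
    by simp
  from assms(1) this obtain d where d: "d > 0" "\<And>p. \<lbrakk>p tagged_division_of {a..b};
      mesh_below d p\<rbrakk> \<Longrightarrow> norm (stieltjes_sum f g p - I) < ?e"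
    by (rule has_rs_integralE) blast
  from assms(2) \<open>?e > 0\<close> obtain d' where d': "d' > 0" "\<And>p. \<lbrakk>p tagged_division_of {a..b};
      mesh_below d' p\<rbrakk> \<Longrightarrow> norm (stieltjes_sum f' g p - J) < ?e"
    by (rule has_rs_integralE) blast
  show "\<exists>d>0. \<forall>p. p tagged_division_of {a..b} \<and> mesh_below d p \<longrightarrow>
      norm (stieltjes_sum (\<lambda>\<theta>. c * f \<theta> + c' * f' \<theta>) g p - (c * I + c' * J)) < e"
  proof (intro exI[of _ "min d d'"] conjI allI impI; (elim conjE)?)
    fix p assume p: "p tagged_division_of {a..b}" "mesh_below (min d d') p"
    then have m: "mesh_below d p" "mesh_below d' p"
      by (auto intro: mesh_below_mono)
    have "stieltjes_sum (\<lambda>\<theta>. c * f \<theta> + c' * f' \<theta>) g p =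
        c * stieltjes_sum f g p + c' * stieltjes_sum f' g p"
      by (simp add: stieltjes_sum_def sum_distrib_left sum.distrib[symmetric] case_prod_unfold
          algebra_simps)
    then have "stieltjes_sum (\<lambda>\<theta>. c * f \<theta> + c' * f' \<theta>) g p - (c * I + c' * J) =
        c * (stieltjes_sum f g p - I) + c' * (stieltjes_sum f' g p - J)"
      by (simp add: algebra_simps)
    also have "norm \<dots> \<le> norm c * ?e + norm c' * ?e"
      using mult_left_mono[OF less_imp_le[OF d(2)[OF p(1) m(1)]] norm_ge_zero[of c]]
        mult_left_mono[OF less_imp_le[OF d'(2)[OF p(1) m(2)]] norm_ge_zero[of c']]
      by (intro order_trans[OF norm_triangle_ineq] add_mono) (simp_all only: norm_mult)
    also have "\<dots> = (norm c + norm c') * e / (norm c + norm c' + 1)"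
      by (simp add: add_divide_distrib distrib_right)
    also have "\<dots> < e"
      using e pos by (simp add: field_simps)
    finally show "norm (stieltjes_sum (\<lambda>\<theta>. c * f \<theta> + c' * f' \<theta>) g p - (c * I + c' * J)) < e" .
  qed (use d d' in auto)
qed

lemma has_rs_integral_bound:
  assumes I: "has_rs_integral f g a b I" and g: "variation_dominated g v a b" and ab: "a \<le> b"
    and M: "\<And>\<theta>. \<theta> \<in> {a..b} \<Longrightarrow> norm (f \<theta>) \<le> M"
  shows "norm I \<le> M * (v b - v a)"
proof -
  obtain p where seq: "refining_sequence p a b"
    using refining_sequence_exists by blast
  then have p: "\<And>n. p n tagged_division_of {a..b}"
    by (simp add: refining_sequence_def)
  have "norm (stieltjes_sum f g (p n)) \<le> M * (v b - v a)" for n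
  proof -
    have "norm (stieltjes_sum f g (p n)) \<le> (\<Sum>(s, K)\<in>p n. M * (v (Sup K) - v (Inf K)))"
      unfolding stieltjes_sum_def
    proof (rule sum_norm_le, clarify)
      fix s K assume "(s, K) \<in> p n"
      note K = tagged_division_of_real_cell[OF p this]
      then have "norm (f s) \<le> M" "norm (g (Sup K) - g (Inf K)) \<le> v (Sup K) - v (Inf K)"
        using M variation_dominatedD[OF g, of "Inf K" "Sup K"] by auto
      then show "norm (f s * (g (Sup K) - g (Inf K))) \<le> M * (v (Sup K) - v (Inf K))"
        unfolding norm_mult by (intro mult_mono) (auto intro: order_trans[OF norm_ge_zero])
    qed
    also have "\<dots> = M * (v b - v a)"
      using additive_tagged_division_1[OF ab p, of v n]
      by (simp add: sum_distrib_left[symmetric] case_prod_unfold)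
    finally show ?thesis .
  qed
  moreover have "(\<lambda>n. norm (stieltjes_sum f g (p n))) \<longlonglongrightarrow> norm I"
    by (intro tendsto_norm has_rs_integral_sequence[OF I seq])
  ultimately show ?thesis
    by (intro LIMSEQ_le_const2) auto
qed

text \<open>A fine division of \<open>[a, c]\<close> extends to a fine division of \<open>[a, b]\<close>, and the cells added to the right
  of \<open>c\<close> contribute nothing to the sums of the frozen integrator.\<close>

lemma rs_integral_cutoff:
  assumes f: "continuous_on {a..b} f" and g: "variation_dominated g v a b"
    and c: "a \<le> c" "c \<le> b"
  shows "rs_integral f g a c = rs_integral f (\<lambda>\<theta>. g (min c \<theta>)) a b"
proof (rule rs_integral_eqI)
  let ?g = "\<lambda>\<theta>. g (min c \<theta>)"
  let ?I = "rs_integral f ?g a b"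
  have I: "has_rs_integral f ?g a b ?I"
    using variation_dominated_cutoff[OF g c(1)] f c by (intro has_rs_integral_cont) auto
  show "has_rs_integral f g a c ?I"
  proof (rule has_rs_integralI)
    fix e :: real assume "e > 0"
    with I obtain d where d: "d > 0" "\<And>p. \<lbrakk>p tagged_division_of {a..b}; mesh_below d p\<rbrakk> \<Longrightarrow>
        norm (stieltjes_sum f ?g p - ?I) < e"
      by (rule has_rs_integralE) blast
    obtain q where q: "q tagged_division_of {c..b}" "mesh_below d q"
      by (rule tagged_division_mesh_exists[OF d(1)])
    show "\<exists>d>0. \<forall>p. p tagged_division_of {a..c} \<and> mesh_below d p \<longrightarrow>
        norm (stieltjes_sum f g p - ?I) < e"
    proof (intro exI[of _ d] conjI allI impI d(1); elim conjE)
      fix p assume p: "p tagged_division_of {a..c}" "mesh_below d p"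
      have "p \<union> q tagged_division_of {a..c} \<union> {c..b}"
        using p q by (intro tagged_division_Un) (auto simp: interior_atLeastAtMost_real)
      moreover have "{a..c} \<union> {c..b} = {a..b}"
        using c by auto
      ultimately have pq: "p \<union> q tagged_division_of {a..b}" by simp
      have zero: "g (min c (Sup K)) = g (min c (Inf K))" if "(s, K) \<in> q" for s K
        using tagged_division_of_real_cell[OF q(1) that] by (simp add: min_def)
      have "stieltjes_sum f ?g (p \<union> q) = stieltjes_sum f ?g p + stieltjes_sum f ?g q"
        unfolding stieltjes_sum_def using p q zero
        by (intro sum.union_inter_neutral) auto
      also have "stieltjes_sum f ?g q = 0"
        unfolding stieltjes_sum_def using zero by (intro sum.neutral) auto
      also have "stieltjes_sum f ?g p = stieltjes_sum f g p"
        unfolding stieltjes_sum_def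
      proof (intro sum.cong refl, clarify)
        fix s K assume "(s, K) \<in> p"
        from tagged_division_of_real_cell(2-5)[OF p(1) this]
        have "min c (Sup K) = Sup K" "min c (Inf K) = Inf K" by auto
        then show "f s * (g (min c (Sup K)) - g (min c (Inf K))) = f s * (g (Sup K) - g (Inf K))"
          by simp
      qed
      finally show "norm (stieltjes_sum f g p - ?I) < e"
        using d(2)[OF pq mesh_below_Un[OF p(2) q(2)]] by simp
    qed
  qed
qed

text \<open>The distance of a single Stieltjes sum from the integral is controlled by the mesh, the modulus of
  continuity of the integrand and the variation of the integrator. The exchange of integrals below
  needs this uniformity, because there both integrand and integrator vary with a parameter.\<close>

lemma stieltjes_sum_error:
  assumes f: "continuous_on {a..b} f" and g: "variation_dominated g v a b" and ab: "a \<le> b"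
    and p: "p tagged_division_of {a..b}" and mp: "mesh_below d p" and d: "d > 0"
    and osc: "\<And>s t. \<lbrakk>s \<in> {a..b}; t \<in> {a..b}; \<bar>s - t\<bar> < 2 * d\<rbrakk> \<Longrightarrow> norm (f s - f t) \<le> e"
  shows "norm (stieltjes_sum f g p - rs_integral f g a b) \<le> e * (v b - v a)"
proof -
  obtain P where P: "refining_sequence P a b"
    using refining_sequence_exists by blast
  have "(\<lambda>n. norm (stieltjes_sum f g p - stieltjes_sum f g (P n)))
      \<longlonglongrightarrow> norm (stieltjes_sum f g p - rs_integral f g a b)"
    by (intro tendsto_intros has_rs_integral_sequence[OF has_rs_integral_cont[OF f g ab] P])
  moreover have "\<forall>\<^sub>F n in sequentially. mesh_below d (P n)"
    using P d by (simp add: refining_sequence_def)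
  then have "\<forall>\<^sub>F n in sequentially.
      norm (stieltjes_sum f g p - stieltjes_sum f g (P n)) \<le> e * (v b - v a)"
  proof eventually_elim
    case (elim n)
    then show ?case
      using P by (intro stieltjes_sum_diff_le[OF p _ ab mp _ osc g]) (auto simp: refining_sequence_def)
  qed
  ultimately show ?thesis
    by (rule tendsto_upperbound) simp
qed

section \<open>Exchanging the order of integration\<close>

text \<open>A function of bounded variation is a difference of monotone functions, hence measurable and bounded.
  Here \<open>Re \<circ> g = (Re \<circ> g + v) - v\<close>, and likewise for the imaginary part.\<close>

lemma variation_dominated_integrable:
  fixes g h :: "real \<Rightarrow> complex"
  assumes g: "variation_dominated g v a b" and h: "continuous_on {a..b} h"
  shows "(\<lambda>x. g x * h x) integrable_on {a..b}"
proof (cases "a \<le> b")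
  case True
  have meas: "f \<in> borel_measurable (lebesgue_on {a..b})" if "mono_on {a..b} f" for f :: "real \<Rightarrow> real"
    using integrable_mono_on[OF that] by simp
  have v: "v \<in> borel_measurable (lebesgue_on {a..b})"
    using variation_dominated_mono[OF g] by (intro meas mono_onI) auto
  have part: "f \<in> borel_measurable (lebesgue_on {a..b})"
    if f: "\<And>x y. \<bar>f y - f x\<bar> \<le> norm (g y - g x)" for f :: "real \<Rightarrow> real"
  proof -
    have "(\<lambda>x. f x + v x) \<in> borel_measurable (lebesgue_on {a..b})"
    proof (intro meas mono_onI)
      fix x y assume "x \<in> {a..b}" "y \<in> {a..b}" "x \<le> y"
      then have "\<bar>f y - f x\<bar> \<le> v y - v x"
        using order_trans[OF f[of y x] variation_dominatedD[OF g, of x y]] by auto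
      then show "f x + v x \<le> f y + v y" by linarith
    qed
    then have "(\<lambda>x. (f x + v x) - v x) \<in> borel_measurable (lebesgue_on {a..b})"
      using v by (rule borel_measurable_diff)
    then show ?thesis by simp
  qed
  have "(\<lambda>x. Re (g x)) \<in> borel_measurable (lebesgue_on {a..b})"
    by (intro part) (metis abs_Re_le_cmod minus_complex.sel(1))
  moreover have "(\<lambda>x. Im (g x)) \<in> borel_measurable (lebesgue_on {a..b})"
    by (intro part) (metis abs_Im_le_cmod minus_complex.sel(2))
  ultimately have "g \<in> borel_measurable (lebesgue_on {a..b})"
    by (simp add: borel_measurable_complex_iff)
  moreover have "bounded (g ` {a..b})"
  proof (rule boundedI)
    fix y assume "y \<in> g ` {a..b}"
    then obtain x where x: "x \<in> {a..b}" "y = g x" by blast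
    then have "norm (g x - g a) \<le> v b - v a"
      using variation_dominatedD[OF g, of a x] variation_dominated_mono[OF g, of x b] by auto
    then show "norm y \<le> norm (g a) + (v b - v a)"
      using norm_triangle_ineq2[of "g x" "g a"] x by simp
  qed
  ultimately have "(\<lambda>x. g x * h x) absolutely_integrable_on {a..b}"
    using absolutely_integrable_bounded_measurable_product[OF bilinear_times _ _ _
        absolutely_integrable_continuous_real[OF h]] by simp
  then show ?thesis
    by (rule set_lebesgue_integral_eq_integral)
qed auto

text \<open>The contribution of one cell \<open>[c, d]\<close> with tag \<open>s\<close> to the error made in the exchange. To the left
  of \<open>c\<close> both integrands vanish and to the right of \<open>d\<close> they agree, so only an interval of
  length \<open>d - c\<close> counts, on which they differ by at most \<open>M * (v d - v c)\<close>.\<close>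

lemma cell_exchange_error:
  fixes q g :: "real \<Rightarrow> complex"
  assumes q: "continuous_on {a..b} q" and g: "variation_dominated g v a b"
    and M: "\<And>\<xi>. \<xi> \<in> {a..b} \<Longrightarrow> norm (q \<xi>) \<le> M"
    and s: "a \<le> c" "c \<le> s" "s \<le> d" "d \<le> b"
  shows "norm (integral {s..b} q * (g d - g c) -
      integral {a..b} (\<lambda>\<xi>. q \<xi> * (g (min \<xi> d) - g (min \<xi> c)))) \<le> M * (d - c) * (v d - v c)"
proof -
  let ?h = "\<lambda>\<xi>. (if \<xi> \<in> {s..b} then q \<xi> * (g d - g c) else 0)"
  let ?k = "\<lambda>\<xi>. q \<xi> * (g (min \<xi> d) - g (min \<xi> c))"
  let ?B = "\<lambda>\<xi>. (if \<xi> \<in> {c..d} then M * (v d - v c) else 0)"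
  have sb: "{s..b} \<inter> {a..b} = {s..b}" "{c..d} \<inter> {a..b} = {c..d}"
    using s by auto
  have h: "?h integrable_on {a..b}" "integral {a..b} ?h = integral {s..b} q * (g d - g c)"
  proof -
    have "continuous_on {s..b} q"
      using q s by (auto intro: continuous_on_subset)
    then have "(\<lambda>\<xi>. q \<xi> * (g d - g c)) integrable_on {s..b}"
      by (intro integrable_continuous_real continuous_intros)
    then show "?h integrable_on {a..b}"
      using integrable_restrict_Int[of "{s..b}" "\<lambda>\<xi>. q \<xi> * (g d - g c)" "{a..b}"] unfolding sb by blast
    show "integral {a..b} ?h = integral {s..b} q * (g d - g c)"
      using integral_restrict_Int[of "{a..b}" "{s..b}" "\<lambda>\<xi>. q \<xi> * (g d - g c)"] unfolding sb by simp
  qed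
  have k: "?k integrable_on {a..b}"
  proof -
    have "(\<lambda>\<xi>. g (min e \<xi>) * q \<xi>) integrable_on {a..b}" if "a \<le> e" for e
      by (rule variation_dominated_integrable[OF variation_dominated_cutoff[OF g that] q])
    from integrable_diff[OF this[of d] this[of c]] s show ?thesis
      by (simp add: algebra_simps min.commute)
  qed
  have B: "?B integrable_on {a..b}" "integral {a..b} ?B = M * (d - c) * (v d - v c)"
  proof -
    show "?B integrable_on {a..b}"
      using integrable_restrict_Int[of "{c..d}" "\<lambda>\<xi>. M * (v d - v c)" "{a..b}"] unfolding sb by blast
    show "integral {a..b} ?B = M * (d - c) * (v d - v c)"
      using integral_restrict_Int[of "{a..b}" "{c..d}" "\<lambda>\<xi>. M * (v d - v c)"] sb s by simp
  qed
  have "norm (?h \<xi> - ?k \<xi>) \<le> ?B \<xi>" if \<xi>: "\<xi> \<in> {a..b}" for \<xi>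
  proof -
    have prod: "norm (q \<xi> * w) \<le> M * (v d - v c)" if "norm w \<le> v d - v c" for w
      unfolding norm_mult using M[OF \<xi>] that
      by (intro mult_mono) (auto intro: order_trans[OF norm_ge_zero])
    consider "\<xi> < c" | "d < \<xi>" | "c \<le> \<xi>" "\<xi> < s" | "s \<le> \<xi>" "\<xi> \<le> d"
      by linarith
    then show ?thesis
    proof cases
      case 1
      then show ?thesis using s by simp
    next
      case 2
      then show ?thesis using s \<xi> by simp
    next
      case 3
      then have "norm (g c - g \<xi>) \<le> v d - v c"
        using variation_dominatedD[OF g, of c \<xi>] variation_dominated_mono[OF g, of \<xi> d] s
        by (simp add: norm_minus_commute)
      moreover have "?h \<xi> - ?k \<xi> = q \<xi> * (g c - g \<xi>)"
        using 3 s by (simp add: algebra_simps)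
      ultimately show ?thesis
        using prod 3 s by auto
    next
      case 4
      then have "norm (g d - g \<xi>) \<le> v d - v c"
        using variation_dominatedD[OF g, of \<xi> d] variation_dominated_mono[OF g, of c \<xi>] s by simp
      moreover have "?h \<xi> - ?k \<xi> = q \<xi> * (g d - g \<xi>)"
        using 4 s \<xi> by (simp add: algebra_simps)
      ultimately show ?thesis
        using prod 4 s by auto
    qed
  qed
  then have "norm (integral {a..b} (\<lambda>\<xi>. ?h \<xi> - ?k \<xi>)) \<le> integral {a..b} ?B"
    by (intro integral_norm_bound_integral integrable_diff h k B)
  then show ?thesis
    unfolding integral_diff[OF h(1) k] h(2) B(2) .
qed

text \<open>A theorem of Fubini type for an ordinary integral over a Riemann--Stieltjes integral with variable
  upper limit:
  \<open>\<integral>\<^sub>a\<^sup>b (\<integral>\<^sub>a\<^sup>\<xi> k (\<xi> - \<theta>) dg(\<theta>)) p(\<xi>) d\<xi> = \<integral>\<^sub>a\<^sup>b (\<integral>\<^sub>\<theta>\<^sup>b k (\<xi> - \<theta>) p(\<xi>) d\<xi>) dg(\<theta>)\<close>.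
  For a division \<open>P\<close> of small mesh, the inner integral on the left is uniformly close to its
  Stieltjes sum \<open>S P \<xi>\<close>; integrating that finite sum against \<open>p\<close> term by term gives, up to the errors of
  the single cells, the Stieltjes sum over \<open>P\<close> of the right-hand side. This proves at once that the
  right-hand Stieltjes integral exists and that the two sides agree.\<close>

lemma convolution_exchange:
  fixes g k p :: "real \<Rightarrow> complex"
  assumes k: "continuous_on {0..b - a} k" and p: "continuous_on {a..b} p"
    and g: "variation_dominated g v a b" and ab: "a \<le> b"
  shows "(\<lambda>\<xi>. rs_integral (\<lambda>\<theta>. k (\<xi> - \<theta>)) g a \<xi> * p \<xi>) integrable_on {a..b}" (is ?int)
    and "has_rs_integral (\<lambda>\<theta>. integral {\<theta>..b} (\<lambda>\<xi>. k (\<xi> - \<theta>) * p \<xi>)) g a b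
           (integral {a..b} (\<lambda>\<xi>. rs_integral (\<lambda>\<theta>. k (\<xi> - \<theta>)) g a \<xi> * p \<xi>))" (is ?exch)
proof -
  \<comment> \<open>Only \<open>\<theta> \<le> \<xi>\<close> matters, but the cut-off integrals run over all \<open>\<theta> \<in> [a, b]\<close> and need a continuous
    kernel there.\<close>
  define k' where "k' u = k (max 0 u)" for u
  have k': "continuous_on {a - b..b - a} k'"
    unfolding k'_def using ab
    by (intro continuous_on_compose2[OF k] continuous_intros) auto
  have k\<xi>: "continuous_on {a..b} (\<lambda>\<theta>. k' (\<xi> - \<theta>))" if "\<xi> \<in> {a..b}" for \<xi>
    using that by (intro continuous_on_compose2[OF k'] continuous_intros) auto
  have k\<theta>: "continuous_on {a..b} (\<lambda>\<xi>. k' (\<xi> - \<theta>))" if "\<theta> \<in> {a..b}" for \<theta>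
    using that by (intro continuous_on_compose2[OF k'] continuous_intros) auto
  let ?g = "\<lambda>\<xi> \<theta>. g (min \<xi> \<theta>)"
  define J where "J \<xi> = rs_integral (\<lambda>\<theta>. k (\<xi> - \<theta>)) g a \<xi>" for \<xi>
  have J: "J \<xi> = rs_integral (\<lambda>\<theta>. k' (\<xi> - \<theta>)) (?g \<xi>) a b" if \<xi>: "\<xi> \<in> {a..b}" for \<xi>
  proof -
    have "J \<xi> = rs_integral (\<lambda>\<theta>. k' (\<xi> - \<theta>)) g a \<xi>"
      unfolding J_def k'_def by (intro rs_integral_cong) (auto simp: max_def)
    also have "\<dots> = rs_integral (\<lambda>\<theta>. k' (\<xi> - \<theta>)) (?g \<xi>) a b"
      using \<xi> by (intro rs_integral_cutoff[OF k\<xi>[OF \<xi>] g]) auto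
    finally show ?thesis .
  qed
  define S where "S P \<xi> = stieltjes_sum (\<lambda>\<theta>. k' (\<xi> - \<theta>)) (?g \<xi>) P" for P \<xi>
  define V where "V = v b - v a"
  have V: "V \<ge> 0"
    using variation_dominated_mono[OF g order_refl ab order_refl] by (simp add: V_def)
  obtain Mp where Mp: "Mp > 0" "\<And>\<xi>. \<xi> \<in> {a..b} \<Longrightarrow> norm (p \<xi>) \<le> Mp"
    using compact_imp_bounded[OF compact_continuous_image[OF p compact_Icc]]
    unfolding bounded_pos by blast
  obtain Mk where Mk: "Mk > 0" "\<And>u. u \<in> {a - b..b - a} \<Longrightarrow> norm (k' u) \<le> Mk"
    using compact_imp_bounded[OF compact_continuous_image[OF k' compact_Icc]]
    unfolding bounded_pos by blast
  have SJ: "\<exists>d>0. \<forall>P \<xi>. P tagged_division_of {a..b} \<and> mesh_below d P \<and> \<xi> \<in> {a..b} \<longrightarrow>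
      norm (S P \<xi> * p \<xi> - J \<xi> * p \<xi>) \<le> e" if e: "e > 0" for e
  proof -
    define e' where "e' = e / (Mp * (V + 1))"
    have e': "e' > 0" "e' * V * Mp \<le> e"
    proof -
      show "e' > 0"
        using e V Mp by (simp add: e'_def)
      have "e' * V * Mp = e * (V / (V + 1))"
        using V Mp(1) by (simp add: e'_def divide_simps)
      also have "\<dots> \<le> e * 1"
        using V e by (intro mult_left_mono) auto
      finally show "e' * V * Mp \<le> e" by simp
    qed
    obtain d where d: "d > 0" "\<And>s t. \<lbrakk>s \<in> {a - b..b - a}; t \<in> {a - b..b - a}; \<bar>s - t\<bar> < d\<rbrakk>
        \<Longrightarrow> norm (k' s - k' t) < e'"
      using uniformly_continuous_modulus[OF k' e'(1)] by blast
    have "norm (S P \<xi> * p \<xi> - J \<xi> * p \<xi>) \<le> e"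
      if P: "P tagged_division_of {a..b}" "mesh_below (d / 2) P" and \<xi>: "\<xi> \<in> {a..b}" for P \<xi>
    proof -
      have "norm (S P \<xi> - J \<xi>) \<le> e' * (v (min \<xi> b) - v (min \<xi> a))"
        unfolding S_def J[OF \<xi>]
      proof (rule stieltjes_sum_error[OF k\<xi>[OF \<xi>] _ ab P])
        show "variation_dominated (?g \<xi>) (\<lambda>\<theta>. v (min \<xi> \<theta>)) a b"
          using \<xi> by (intro variation_dominated_cutoff[OF g]) auto
        show "norm (k' (\<xi> - s) - k' (\<xi> - t)) \<le> e'"
          if "s \<in> {a..b}" "t \<in> {a..b}" "\<bar>s - t\<bar> < 2 * (d / 2)" for s t
          using that \<xi> by (intro less_imp_le[OF d(2)]) auto
      qed (use d in simp)
      also have "\<dots> \<le> e' * V"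
        using \<xi> e'(1) variation_dominated_mono[OF g, of \<xi> b] by (simp add: V_def min_absorb1 min_absorb2)
      finally have "norm (S P \<xi> - J \<xi>) * norm (p \<xi>) \<le> e' * V * Mp"
        using Mp \<xi> V e'(1) by (intro mult_mono) auto
      then show ?thesis
        using e'(2) by (simp add: norm_mult[symmetric] left_diff_distrib)
    qed
    with d(1) show ?thesis
      by (intro exI[of _ "d / 2"]) auto
  qed
  have summand: "(\<lambda>\<xi>. k' (\<xi> - s) * p \<xi> * (g (min \<xi> (Sup K)) - g (min \<xi> (Inf K)))) integrable_on {a..b}"
    if "s \<in> {a..b}" "a \<le> Inf K" "a \<le> Sup K" for s K
  proof -
    have q: "continuous_on {a..b} (\<lambda>\<xi>. k' (\<xi> - s) * p \<xi>)"
      by (intro continuous_intros k\<theta> p that)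
    have "(\<lambda>\<xi>. g (min e \<xi>) * (k' (\<xi> - s) * p \<xi>)) integrable_on {a..b}" if "a \<le> e" for e
      by (rule variation_dominated_integrable[OF variation_dominated_cutoff[OF g that] q])
    from integrable_diff[OF this[of "Sup K"] this[of "Inf K"]] that show ?thesis
      by (simp add: algebra_simps min.commute)
  qed
  have Sp: "S P \<xi> * p \<xi> =
      (\<Sum>(s, K)\<in>P. k' (\<xi> - s) * p \<xi> * (g (min \<xi> (Sup K)) - g (min \<xi> (Inf K))))" for P \<xi>
    by (simp add: S_def stieltjes_sum_def sum_distrib_left case_prod_unfold mult_ac)
  have Sint: "(\<lambda>\<xi>. S P \<xi> * p \<xi>) integrable_on {a..b}"
    and Sval: "integral {a..b} (\<lambda>\<xi>. S P \<xi> * p \<xi>) = (\<Sum>(s, K)\<in>P.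
      integral {a..b} (\<lambda>\<xi>. k' (\<xi> - s) * p \<xi> * (g (min \<xi> (Sup K)) - g (min \<xi> (Inf K)))))"
    if P: "P tagged_division_of {a..b}" for P
  proof -
    have fin: "finite P" using P by auto
    have ints: "(\<lambda>\<xi>. k' (\<xi> - fst sK) * p \<xi> * (g (min \<xi> (Sup (snd sK))) - g (min \<xi> (Inf (snd sK)))))
        integrable_on {a..b}" if "sK \<in> P" for sK
      using tagged_division_of_real_cell(2-5)[OF P, of "fst sK" "snd sK"] that
      by (intro summand) auto
    show "(\<lambda>\<xi>. S P \<xi> * p \<xi>) integrable_on {a..b}"
      unfolding Sp case_prod_unfold by (intro integrable_sum fin ints)
    show "integral {a..b} (\<lambda>\<xi>. S P \<xi> * p \<xi>) = (\<Sum>(s, K)\<in>P.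
      integral {a..b} (\<lambda>\<xi>. k' (\<xi> - s) * p \<xi> * (g (min \<xi> (Sup K)) - g (min \<xi> (Inf K)))))"
      unfolding Sp case_prod_unfold by (intro integral_sum fin ints)
  qed
  have Jint: "(\<lambda>\<xi>. J \<xi> * p \<xi>) integrable_on {a..b}"
  proof -
    have "\<exists>h. (\<forall>\<xi>\<in>cbox a b. norm (J \<xi> * p \<xi> - h \<xi>) \<le> e) \<and> h integrable_on cbox a b" if e: "e > 0" for e
    proof -
      obtain d where d: "d > 0" "\<And>P \<xi>. \<lbrakk>P tagged_division_of {a..b}; mesh_below d P; \<xi> \<in> {a..b}\<rbrakk> \<Longrightarrow>
          norm (S P \<xi> * p \<xi> - J \<xi> * p \<xi>) \<le> e"
        using SJ[OF e] by blast
      obtain P where P: "P tagged_division_of {a..b}" "mesh_below d P"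
        by (rule tagged_division_mesh_exists[OF d(1)])
      show ?thesis
        using d(2)[OF P] Sint[OF P(1)]
        by (intro exI[of _ "\<lambda>\<xi>. S P \<xi> * p \<xi>"]) (auto simp: norm_minus_commute)
    qed
    then show ?thesis
      using integrable_uniform_limit[of a b "\<lambda>\<xi>. J \<xi> * p \<xi>"] by simp
  qed
  then show ?int
    by (simp add: J_def)
  have "has_rs_integral (\<lambda>\<theta>. integral {\<theta>..b} (\<lambda>\<xi>. k (\<xi> - \<theta>) * p \<xi>)) g a b
      (integral {a..b} (\<lambda>\<xi>. J \<xi> * p \<xi>))"
  proof (rule has_rs_integralI)
    fix e :: real assume e: "e > 0"
    define M where "M = Mk * Mp"
    have M: "M > 0"
      using Mk Mp by (simp add: M_def)
    define e1 where "e1 = e / (2 * (b - a + 1))"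
    have e1: "e1 > 0" "e1 * (b - a) < e / 2"
    proof -
      show "e1 > 0" using e ab by (simp add: e1_def)
      then have "e1 * (b - a) < e1 * (b - a + 1)" by simp
      also have "\<dots> = e / 2" using ab by (simp add: e1_def field_simps)
      finally show "e1 * (b - a) < e / 2" .
    qed
    \<comment> \<open>\<open>e1\<close> bounds the error of the inner Stieltjes sums, \<open>d2\<close> the mesh for the cell errors;
      each accounts for half of \<open>e\<close>.\<close>
    define d2 where "d2 = e / (2 * M * (V + 1))"
    have d2: "d2 > 0" "M * d2 * V \<le> e / 2"
    proof -
      show "d2 > 0" using e M V by (simp add: d2_def)
      have "M * d2 * V = e / 2 * (V / (V + 1))"
        using M V by (simp add: d2_def divide_simps)
      also have "\<dots> \<le> e / 2 * 1"
        using V e by (intro mult_left_mono) auto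
      finally show "M * d2 * V \<le> e / 2" by simp
    qed
    obtain d1 where d1: "d1 > 0"
      "\<And>P \<xi>. \<lbrakk>P tagged_division_of {a..b}; mesh_below d1 P; \<xi> \<in> {a..b}\<rbrakk> \<Longrightarrow>
        norm (S P \<xi> * p \<xi> - J \<xi> * p \<xi>) \<le> e1"
      using SJ[OF e1(1)] by blast
    have "norm (stieltjes_sum (\<lambda>\<theta>. integral {\<theta>..b} (\<lambda>\<xi>. k (\<xi> - \<theta>) * p \<xi>)) g P
        - integral {a..b} (\<lambda>\<xi>. J \<xi> * p \<xi>)) < e"
      if P: "P tagged_division_of {a..b}" and m: "mesh_below (min d1 d2) P" for P
    proof -
      have m1: "mesh_below d1 P" and m2: "mesh_below d2 P"
        using m by (auto intro: mesh_below_mono)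
      have "norm (integral {a..b} (\<lambda>\<xi>. S P \<xi> * p \<xi> - J \<xi> * p \<xi>)) \<le> integral {a..b} (\<lambda>\<xi>. e1)"
        using d1(2)[OF P m1] by (intro integral_norm_bound_integral integrable_diff Sint[OF P] Jint) auto
      then have 1: "norm (integral {a..b} (\<lambda>\<xi>. S P \<xi> * p \<xi>) - integral {a..b} (\<lambda>\<xi>. J \<xi> * p \<xi>))
          < e / 2"
        using integral_diff[OF Sint[OF P] Jint] e1(2) ab by (simp add: mult.commute)
      have "norm (stieltjes_sum (\<lambda>\<theta>. integral {\<theta>..b} (\<lambda>\<xi>. k (\<xi> - \<theta>) * p \<xi>)) g P
          - integral {a..b} (\<lambda>\<xi>. S P \<xi> * p \<xi>)) \<le> (\<Sum>(s, K)\<in>P. M * d2 * (v (Sup K) - v (Inf K)))"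
        unfolding Sval[OF P] stieltjes_sum_def case_prod_unfold sum_subtractf[symmetric]
      proof (rule sum_norm_le, clarsimp)
        fix s K assume sK: "(s, K) \<in> P"
        note K = tagged_division_of_real_cell(2-5)[OF P sK]
        have s: "s \<in> {a..b}" using K by auto
        have "integral {s..b} (\<lambda>\<xi>. k (\<xi> - s) * p \<xi>) = integral {s..b} (\<lambda>\<xi>. k' (\<xi> - s) * p \<xi>)"
          by (intro integral_cong) (simp add: k'_def max_def)
        moreover have "norm (integral {s..b} (\<lambda>\<xi>. k' (\<xi> - s) * p \<xi>) * (g (Sup K) - g (Inf K)) -
            integral {a..b} (\<lambda>\<xi>. k' (\<xi> - s) * p \<xi> * (g (min \<xi> (Sup K)) - g (min \<xi> (Inf K)))))
            \<le> M * (Sup K - Inf K) * (v (Sup K) - v (Inf K))"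
        proof (rule cell_exchange_error[OF _ g _ K])
          show "continuous_on {a..b} (\<lambda>\<xi>. k' (\<xi> - s) * p \<xi>)"
            by (intro continuous_intros k\<theta> p s)
          show "norm (k' (\<xi> - s) * p \<xi>) \<le> M" if "\<xi> \<in> {a..b}" for \<xi>
            unfolding M_def norm_mult using that s Mk(1)
            by (intro mult_mono Mk(2) Mp(2)) auto
        qed
        moreover have "M * (Sup K - Inf K) * (v (Sup K) - v (Inf K)) \<le> M * d2 * (v (Sup K) - v (Inf K))"
          using K M mesh_belowD[OF m2 sK] variation_dominated_mono[OF g, of "Inf K" "Sup K"]
          by (intro mult_right_mono mult_left_mono) auto
        ultimately show "norm (integral {s..b} (\<lambda>\<xi>. k (\<xi> - s) * p \<xi>) * (g (Sup K) - g (Inf K)) -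
            integral {a..b} (\<lambda>\<xi>. k' (\<xi> - s) * p \<xi> * (g (min \<xi> (Sup K)) - g (min \<xi> (Inf K)))))
            \<le> M * d2 * (v (Sup K) - v (Inf K))" by simp
      qed
      also have "\<dots> = M * d2 * V"
        using additive_tagged_division_1[OF ab P, of v]
        by (simp add: sum_distrib_left[symmetric] case_prod_unfold V_def)
      finally have 2: "norm (stieltjes_sum (\<lambda>\<theta>. integral {\<theta>..b} (\<lambda>\<xi>. k (\<xi> - \<theta>) * p \<xi>)) g P
          - integral {a..b} (\<lambda>\<xi>. S P \<xi> * p \<xi>)) \<le> e / 2"
        using d2(2) by linarith
      have "norm (x - z) < e" if "norm (x - y) \<le> e / 2" "norm (y - z) < e / 2" for x y z :: complex
        using norm_triangle_ineq[of "x - y" "y - z"] that by simp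
      from this[OF 2 1] show ?thesis .
    qed
    then show "\<exists>d>0. \<forall>P. P tagged_division_of {a..b} \<and> mesh_below d P \<longrightarrow>
        norm (stieltjes_sum (\<lambda>\<theta>. integral {\<theta>..b} (\<lambda>\<xi>. k (\<xi> - \<theta>) * p \<xi>)) g P
        - integral {a..b} (\<lambda>\<xi>. J \<xi> * p \<xi>)) < e"
      using d1 d2 by (intro exI[of _ "min d1 d2"]) auto
  qed
  then show ?exch
    by (simp add: J_def)
qed

section \<open>Differentiation under the Riemann--Stieltjes integral\<close>

text \<open>By the mean value inequality the difference quotients of \<open>H\<close> converge to \<open>Q\<close> uniformly in \<open>\<theta>\<close>,
  and uniform convergence of integrands passes to the Stieltjes integrals by
  \<open>has_rs_integral_bound\<close>.\<close>

lemma has_vector_derivative_rs_integral: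
  fixes H Q :: "real \<Rightarrow> real \<Rightarrow> complex"
  assumes R: "\<And>s. s \<in> {u..w} \<Longrightarrow> has_rs_integral (H s) g a b (R s)"
    and der: "\<And>\<theta> s. \<lbrakk>\<theta> \<in> {a..b}; s \<in> {u..w}\<rbrakk> \<Longrightarrow>
        ((\<lambda>s. H s \<theta>) has_vector_derivative Q s \<theta>) (at s within {u..w})"
    and Q: "continuous_on ({u..w} \<times> {a..b}) (\<lambda>(s, \<theta>). Q s \<theta>)"
    and g: "variation_dominated g v a b" and ab: "a \<le> b" and s: "s \<in> {u..w}"
  shows "(R has_vector_derivative rs_integral (Q s) g a b) (at s within {u..w})"
proof -
  let ?I = "rs_integral (Q s) g a b"
  define V where "V = v b - v a"
  have V: "V \<ge> 0"
    using variation_dominated_mono[OF g order_refl ab order_refl] by (simp add: V_def)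
  have Qs: "continuous_on {a..b} (Q s)"
    using s by (intro continuous_on_compose2[OF Q, of _ "\<lambda>\<theta>. (s, \<theta>)", simplified]) (auto intro!: continuous_intros)
  have I: "has_rs_integral (Q s) g a b ?I"
    by (rule has_rs_integral_cont[OF Qs g ab])
  have "\<exists>d>0. \<forall>y\<in>{u..w}. norm (y - s) < d \<longrightarrow>
      norm (R y - R s - (y - s) *\<^sub>R ?I) \<le> e * norm (y - s)" if e: "e > 0" for e
  proof -
    define e' where "e' = e / (V + 1)"
    have e': "e' > 0" "e' * V \<le> e"
      using e V by (auto simp: e'_def field_simps)
    have "uniformly_continuous_on ({u..w} \<times> {a..b}) (\<lambda>(s, \<theta>). Q s \<theta>)"
      by (intro compact_uniformly_continuous Q compact_Times) auto
    then obtain d where d: "d > 0" "\<And>s' s \<theta>. \<lbrakk>s' \<in> {u..w}; s \<in> {u..w}; \<theta> \<in> {a..b}; dist s' s < d\<rbrakk>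
        \<Longrightarrow> norm (Q s' \<theta> - Q s \<theta>) < e'"
      using e'(1) unfolding uniformly_continuous_on_def
      by (force simp: dist_Pair_Pair dist_norm)
    have "norm (R y - R s - (y - s) *\<^sub>R ?I) \<le> e * norm (y - s)"
      if y: "y \<in> {u..w}" "norm (y - s) < d" for y
    proof -
      have seg: "closed_segment s y \<subseteq> {u..w}"
        using s y by (auto simp: closed_segment_eq_real_ivl)
      let ?f = "\<lambda>\<theta>. 1 * (1 * H y \<theta> + (-1) * H s \<theta>) + complex_of_real (- (y - s)) * Q s \<theta>"
      have "has_rs_integral ?f g a b (1 * (1 * R y + (-1) * R s) + complex_of_real (- (y - s)) * ?I)"
        by (intro has_rs_integral_lincomb R I s y)
      moreover have "norm (?f \<theta>) \<le> norm (y - s) * e'" if \<theta>: "\<theta> \<in> {a..b}" for \<theta>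
      proof -
        have "norm (H y \<theta> - H s \<theta> - (y - s) *\<^sub>R Q s \<theta>) \<le> norm (y - s) * e'"
        proof (rule vector_differentiable_bound_linearization[where S = "closed_segment s y"
              and f = "\<lambda>s. H s \<theta>" and f' = "\<lambda>s. Q s \<theta>"])
          fix x assume x: "x \<in> closed_segment s y"
          then show "((\<lambda>s. H s \<theta>) has_vector_derivative Q x \<theta>) (at x within closed_segment s y)"
            using has_vector_derivative_within_subset[OF der[OF \<theta>] seg] seg by blast
          have "dist x s \<le> norm (y - s)"
            using segment_bound(1)[OF x] by (simp add: dist_norm)
          then show "norm (Q x \<theta> - Q s \<theta>) \<le> e'"
            using x seg s \<theta> y(2) by (intro less_imp_le[OF d(2)]) auto
        qed auto
        then show ?thesis
          by (simp add: scaleR_conv_of_real algebra_simps)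
      qed
      ultimately have "norm (1 * (1 * R y + (-1) * R s) + complex_of_real (- (y - s)) * ?I)
          \<le> norm (y - s) * e' * (v b - v a)"
        by (rule has_rs_integral_bound[OF _ g ab])
      also have "\<dots> = norm (y - s) * (e' * V)"
        by (simp add: V_def)
      also have "\<dots> \<le> norm (y - s) * e"
        using e' by (intro mult_left_mono) auto
      finally show ?thesis
        by (simp add: scaleR_conv_of_real algebra_simps)
    qed
    with d(1) show ?thesis by blast
  qed
  then show ?thesis
    unfolding has_vector_derivative_def has_derivative_within_alt
    by (auto intro: bounded_linear_scaleR_left)
qed

section \<open>Linear delay equations\<close>

lemma integral_has_vector_derivative_half_line:
  fixes h :: "real \<Rightarrow> 'a::euclidean_space"
  assumes h: "continuous_on {0..} h" and t: "t \<ge> 0"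
  shows "((\<lambda>t. integral {0..t} h) has_vector_derivative h t) (at t within {0..})"
proof -
  have "((\<lambda>t. integral {0..t} h) has_vector_derivative h t) (at t within {0..t + 1})"
    using t by (intro integral_has_vector_derivative continuous_on_subset[OF h]) auto
  moreover have "at t within {0..} = at t within {0..t + 1}"
    by (rule at_within_nhd[of _ "{..<t + 1}"]) auto
  ultimately show ?thesis by simp
qed

text \<open>In the norm weighted by \<open>exp (- \<gamma> * t)\<close>, integration from \<open>0\<close> has norm at most \<open>1 / \<gamma>\<close>. A large
  \<open>\<gamma>\<close> thus makes the integral operator of a linear delay equation a contraction on the whole half-line.\<close>

lemma exponential_integral_bound:
  fixes h :: "real \<Rightarrow> 'a::euclidean_space"
  assumes h: "continuous_on {0..T} h" and T: "T \<ge> 0" and \<gamma>: "\<gamma> > 0"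
    and bound: "\<And>s. s \<in> {0..T} \<Longrightarrow> norm (h s) \<le> c * exp (\<gamma> * s)"
  shows "exp (- \<gamma> * T) * norm (integral {0..T} h) \<le> c / \<gamma>"
proof -
  have "0 \<le> c * exp (\<gamma> * 0)"
    using bound[of 0] T norm_ge_zero order_trans by (metis atLeastAtMost_iff order_refl)
  then have c: "0 \<le> c" by simp
  have I: "((\<lambda>s. c * exp (\<gamma> * s)) has_integral c * exp (\<gamma> * T) / \<gamma> - c * exp (\<gamma> * 0) / \<gamma>) {0..T}"
  proof (rule fundamental_theorem_of_calculus[OF T])
    fix s
    show "((\<lambda>s. c * exp (\<gamma> * s) / \<gamma>) has_vector_derivative c * exp (\<gamma> * s)) (at s within {0..T})"
      unfolding has_real_derivative_iff_has_vector_derivative[symmetric]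
      using \<gamma> by (auto intro!: derivative_eq_intros)
  qed
  have "norm (integral {0..T} h) \<le> integral {0..T} (\<lambda>s. c * exp (\<gamma> * s))"
    by (rule integral_norm_bound_integral[OF integrable_continuous_real[OF h] has_integral_integrable[OF I] bound])
  also have "\<dots> = c * exp (\<gamma> * T) / \<gamma> - c / \<gamma>"
    using integral_unique[OF I] by simp
  also have "\<dots> \<le> c / \<gamma> * exp (\<gamma> * T)"
    using c \<gamma> by simp
  finally show ?thesis
    by (simp add: exp_minus field_simps)
qed

text \<open>The right-hand side of the equation \<open>x'(t) = A x\<^sub>t\<close> as a bounded linear functional of the history over
  \<open>[-r, 0]\<close>. Histories are represented by total functions; \<open>local\<close> says that \<open>A\<close> only sees their
  restriction to \<open>[-r, 0]\<close>.\<close>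

locale delay_functional =
  fixes A :: "(real \<Rightarrow> 'a::euclidean_space) \<Rightarrow> 'a" and r V :: real
  assumes r: "r > 0" and V: "V \<ge> 0"
    and local: "(\<And>\<theta>. \<theta> \<in> {-r..0} \<Longrightarrow> f \<theta> = g \<theta>) \<Longrightarrow> A f = A g"
    and diff: "\<lbrakk>continuous_on {-r..0} f; continuous_on {-r..0} g\<rbrakk> \<Longrightarrow>
      A (\<lambda>\<theta>. f \<theta> - g \<theta>) = A f - A g"
    and bound: "\<lbrakk>continuous_on {-r..0} f; \<And>\<theta>. \<theta> \<in> {-r..0} \<Longrightarrow> norm (f \<theta>) \<le> M\<rbrakk> \<Longrightarrow>
      norm (A f) \<le> V * M"
begin

definition delay_solution :: "(real \<Rightarrow> 'a) \<Rightarrow> (real \<Rightarrow> 'a) \<Rightarrow> bool" where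
  "delay_solution \<phi> x \<longleftrightarrow> continuous_on {-r..} x \<and> (\<forall>\<theta>\<in>{-r..0}. x \<theta> = \<phi> \<theta>) \<and>
     (\<forall>t\<ge>0. (x has_vector_derivative A (\<lambda>\<theta>. x (t + \<theta>))) (at t within {0..}))"

lemma lipschitz:
  assumes "continuous_on {-r..0} f" "continuous_on {-r..0} g"
    and "\<And>\<theta>. \<theta> \<in> {-r..0} \<Longrightarrow> norm (f \<theta> - g \<theta>) \<le> M"
  shows "norm (A f - A g) \<le> V * M"
  unfolding diff[OF assms(1,2), symmetric]
  by (rule bound) (use assms in \<open>auto intro: continuous_intros\<close>)

lemma history_continuous:
  assumes "continuous_on {-r..} x" "t \<ge> 0"
  shows "continuous_on {-r..0} (\<lambda>\<theta>. x (t + \<theta>))"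
  using assms(2) by (intro continuous_on_compose2[OF assms(1)] continuous_intros) auto

lemma functional_continuous:
  assumes x: "continuous_on {-r..} x"
  shows "continuous_on {0..} (\<lambda>s. A (\<lambda>\<theta>. x (s + \<theta>)))"
proof -
  have "continuous_on {0..<T} (\<lambda>s. A (\<lambda>\<theta>. x (s + \<theta>)))" for T
    unfolding continuous_on_iff
  proof (intro ballI allI impI)
    fix s e :: real assume s: "s \<in> {0..<T}" and e: "e > 0"
    define e' where "e' = e / (V + 1)"
    have e': "e' > 0" "V * e' < e"
      using e V by (auto simp: e'_def field_simps)
    have "continuous_on {-r..T} x"
      using x by (rule continuous_on_subset) auto
    then obtain d where d: "d > 0"
      "\<And>s t. \<lbrakk>s \<in> {-r..T}; t \<in> {-r..T}; \<bar>s - t\<bar> < d\<rbrakk> \<Longrightarrow> norm (x s - x t) < e'"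
      using uniformly_continuous_modulus e'(1) by blast
    show "\<exists>d>0. \<forall>s'\<in>{0..<T}. dist s' s < d \<longrightarrow>
        dist (A (\<lambda>\<theta>. x (s' + \<theta>))) (A (\<lambda>\<theta>. x (s + \<theta>))) < e"
    proof (intro exI[of _ d] conjI ballI impI d(1))
      fix s' assume s': "s' \<in> {0..<T}" "dist s' s < d"
      have "norm (A (\<lambda>\<theta>. x (s' + \<theta>)) - A (\<lambda>\<theta>. x (s + \<theta>))) \<le> V * e'"
      proof (rule lipschitz)
        fix \<theta> assume "\<theta> \<in> {-r..0}"
        then show "norm (x (s' + \<theta>) - x (s + \<theta>)) \<le> e'"
          using s s' by (intro less_imp_le[OF d(2)]) (auto simp: dist_real_def)
      qed (use s s' in \<open>auto intro: history_continuous[OF x]\<close>)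
      then show "dist (A (\<lambda>\<theta>. x (s' + \<theta>))) (A (\<lambda>\<theta>. x (s + \<theta>))) < e"
        using e'(2) by (simp add: dist_norm)
    qed
  qed
  then have "continuous (at s within {0..<s + 1}) (\<lambda>s. A (\<lambda>\<theta>. x (s + \<theta>)))" if "s \<ge> 0" for s
    using that by (simp add: continuous_on_eq_continuous_within)
  moreover have "at s within {0..} = at s within {0..<s + 1}" for s :: real
    by (rule at_within_nhd[of _ "{..<s + 1}"]) auto
  ultimately show ?thesis
    by (simp add: continuous_on_eq_continuous_within)
qed

text \<open>The solution \<open>x\<close> is found through \<open>w t = exp (- \<gamma> * max 0 t) *\<^sub>R x t\<close>, which is a fixed point of a
  contraction \<open>F\<close> of the bounded continuous functions on the line: \<open>F\<close> is the integrated equation in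
  the weighted norm. Below, \<open>X w\<close> is \<open>w\<close> with the weight removed and \<open>h w\<close> the resulting right-hand
  side.\<close>

lemma delay_solution_exists:
  assumes \<phi>: "continuous_on {-r..0} \<phi>"
  shows "\<exists>x. delay_solution \<phi> x"
proof -
  define \<gamma> where "\<gamma> = V + 1"
  have \<gamma>: "\<gamma> > 0" using V by (simp add: \<gamma>_def)
  \<comment> \<open>The constant continuation of the initial function to the whole line.\<close>
  define \<phi>' where "\<phi>' t = \<phi> (max (-r) (min 0 t))" for t
  have \<phi>': "continuous_on UNIV \<phi>'"
    unfolding \<phi>'_def using r by (intro continuous_on_compose2[OF \<phi>] continuous_intros) auto
  obtain M where M: "\<And>\<theta>. \<theta> \<in> {-r..0} \<Longrightarrow> norm (\<phi> \<theta>) \<le> M"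
    using compact_imp_bounded[OF compact_continuous_image[OF \<phi> compact_Icc]]
    unfolding bounded_iff by blast
  have M': "norm (\<phi>' t) \<le> M" for t
    unfolding \<phi>'_def using r by (intro M) auto
  define X where "X w u = exp (\<gamma> * max 0 u) *\<^sub>R apply_bcontfun w u" for w :: "real \<Rightarrow>\<^sub>C 'a" and u
  define h where "h w s = A (\<lambda>\<theta>. X w (s + \<theta>))" for w s
  define F where "F w t = exp (- \<gamma> * max 0 t) *\<^sub>R (\<phi>' t + integral {0..max 0 t} (h w))" for w t
  have X: "continuous_on S (X w)" for S w
    unfolding X_def by (intro continuous_intros continuous_on_apply_bcontfun)
  have h: "continuous_on {0..} (h w)" for w
    unfolding h_def by (rule functional_continuous[OF X])
  have hdiff: "norm (h w s - h w' s) \<le> V * dist w w' * exp (\<gamma> * s)" if s: "s \<ge> 0" for w w' s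
  proof -
    have "norm (h w s - h w' s) \<le> V * (exp (\<gamma> * s) * dist w w')"
      unfolding h_def
    proof (rule lipschitz)
      fix \<theta> assume \<theta>: "\<theta> \<in> {-r..0}"
      have "norm (X w (s + \<theta>) - X w' (s + \<theta>)) =
          exp (\<gamma> * max 0 (s + \<theta>)) * dist (apply_bcontfun w (s + \<theta>)) (apply_bcontfun w' (s + \<theta>))"
        by (simp add: X_def dist_norm scaleR_diff_right[symmetric])
      also have "\<dots> \<le> exp (\<gamma> * s) * dist w w'"
        using \<theta> s \<gamma> by (intro mult_mono dist_bounded) auto
      finally show "norm (X w (s + \<theta>) - X w' (s + \<theta>)) \<le> exp (\<gamma> * s) * dist w w'" .
    qed (use s in \<open>auto intro: history_continuous[OF X]\<close>)
    then show ?thesis by (simp add: mult_ac)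
  qed
  have h0: "h 0 s = 0" for s
    using diff[of "\<lambda>_. 0" "\<lambda>_. 0"] by (simp add: h_def X_def)
  have Icont: "continuous_on {0..} (\<lambda>t. integral {0..t} (h w))" for w
    using has_vector_derivative_continuous[OF integral_has_vector_derivative_half_line[OF h]]
    by (simp add: continuous_on_eq_continuous_within)
  \<comment> \<open>One estimate gives both the contraction property and, with \<open>w' = 0\<close>, boundedness of \<open>F w\<close>.\<close>
  have contr: "exp (- \<gamma> * T) * norm (integral {0..T} (\<lambda>s. h w s - h w' s)) \<le> V * dist w w' / \<gamma>"
    if T: "T \<ge> 0" for T w w'
    using T hdiff by (intro exponential_integral_bound[OF _ T \<gamma>] continuous_intros continuous_on_subset[OF h]) auto
  have Fb: "F w \<in> bcontfun" for w
  proof (rule bcontfun_normI)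
    show "continuous_on UNIV (F w)"
      unfolding F_def by (intro continuous_intros \<phi>' continuous_on_compose2[OF Icont]) auto
    fix t
    have "norm (F w t) \<le> exp (- \<gamma> * max 0 t) * norm (\<phi>' t)
        + exp (- \<gamma> * max 0 t) * norm (integral {0..max 0 t} (h w))"
      unfolding F_def by (simp add: distrib_left[symmetric] norm_triangle_ineq)
    also have "\<dots> \<le> 1 * M + V * dist w 0 / \<gamma>"
      using contr[of "max 0 t" w 0] M'[of t] \<gamma>
      by (intro add_mono mult_mono) (auto simp: h0)
    finally show "norm (F w t) \<le> M + V * dist w 0 / \<gamma>" by simp
  qed
  have "dist (Bcontfun (F w)) (Bcontfun (F w')) \<le> V / \<gamma> * dist w w'" for w w'
  proof (rule dist_bound)
    fix t
    have hw: "h w integrable_on {0..max 0 t}" for w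
      by (intro integrable_continuous_real continuous_on_subset[OF h]) auto
    have "dist (F w t) (F w' t) =
        exp (- \<gamma> * max 0 t) * norm (integral {0..max 0 t} (\<lambda>s. h w s - h w' s))"
      unfolding F_def dist_norm scaleR_diff_right[symmetric] integral_diff[OF hw hw] by simp
    with contr[of "max 0 t" w w']
    show "dist (apply_bcontfun (Bcontfun (F w)) t) (apply_bcontfun (Bcontfun (F w')) t) \<le> V / \<gamma> * dist w w'"
      by (simp add: Bcontfun_inverse[OF Fb])
  qed
  then obtain w where "Bcontfun (F w) = w"
    using banach_fix_type[of "V / \<gamma>" "\<lambda>w. Bcontfun (F w)"] V by (auto simp: \<gamma>_def)
  then have w: "F w t = apply_bcontfun w t" for t
    by (metis Bcontfun_inverse Fb)
  have x: "X w t = \<phi>' t + integral {0..max 0 t} (h w)" for t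
    by (simp add: X_def w[symmetric] F_def exp_minus)
  have "delay_solution \<phi> (X w)"
    unfolding delay_solution_def
  proof (intro conjI ballI allI impI)
    show "X w \<theta> = \<phi> \<theta>" if "\<theta> \<in> {-r..0}" for \<theta>
      using that by (simp add: x \<phi>'_def max_absorb1 max_absorb2 min_absorb2)
    fix t :: real assume t: "t \<ge> 0"
    have "((\<lambda>t. \<phi> 0 + integral {0..t} (h w)) has_vector_derivative 0 + h w t) (at t within {0..})"
      by (intro derivative_intros integral_has_vector_derivative_half_line[OF h t])
    then have "((\<lambda>t. \<phi> 0 + integral {0..t} (h w)) has_vector_derivative A (\<lambda>\<theta>. X w (t + \<theta>))) (at t within {0..})"
      by (simp add: h_def)
    then show "(X w has_vector_derivative A (\<lambda>\<theta>. X w (t + \<theta>))) (at t within {0..})"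
      using t r by (rule_tac has_vector_derivative_transform[rotated 2]) (auto simp: x \<phi>'_def max_def min_def)
  qed (rule X)
  then show ?thesis by blast
qed

text \<open>If \<open>m\<close> is the maximum of the weighted distance of two solutions over \<open>[0, T]\<close>, attained at \<open>t0\<close>, then
  integrating the equation up to \<open>t0\<close> gives \<open>m \<le> (V / \<gamma>) * m\<close>, and \<open>V / \<gamma> < 1\<close>.\<close>

lemma delay_solution_unique:
  assumes x: "delay_solution \<phi> x" and y: "delay_solution \<phi> y" and T: "T \<ge> -r"
  shows "x T = y T"
proof (cases "T \<le> 0")
  case True
  then show ?thesis
    using x y T by (simp add: delay_solution_def)
next
  case False
  then have T0: "T \<ge> 0" by simp
  define \<gamma> where "\<gamma> = V + 1"
  have \<gamma>: "\<gamma> > 0" using V by (simp add: \<gamma>_def)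
  have cont: "continuous_on {-r..} x" "continuous_on {-r..} y"
    and der: "\<And>t. t \<ge> 0 \<Longrightarrow> (x has_vector_derivative A (\<lambda>\<theta>. x (t + \<theta>))) (at t within {0..})"
      "\<And>t. t \<ge> 0 \<Longrightarrow> (y has_vector_derivative A (\<lambda>\<theta>. y (t + \<theta>))) (at t within {0..})"
    and init: "\<And>\<theta>. \<theta> \<in> {-r..0} \<Longrightarrow> x \<theta> = y \<theta>"
    using x y by (auto simp: delay_solution_def)
  let ?f = "\<lambda>t. exp (- \<gamma> * t) * norm (x t - y t)"
  have "continuous_on {0..T} ?f"
    using r by (intro continuous_intros continuous_on_subset[OF cont(1)] continuous_on_subset[OF cont(2)]) auto
  then obtain t0 where t0: "t0 \<in> {0..T}" and max: "\<And>t. t \<in> {0..T} \<Longrightarrow> ?f t \<le> ?f t0"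
    using continuous_attains_sup[of "{0..T}" ?f] T0 by auto
  define m where "m = ?f t0"
  have m: "m \<ge> 0" by (simp add: m_def)
  \<comment> \<open>For \<open>t \<le> 0\<close> the solutions agree, and for \<open>0 \<le> t \<le> s\<close> the factor \<open>exp (\<gamma> * t)\<close> is at most \<open>exp (\<gamma> * s)\<close>.\<close>
  have le: "norm (x t - y t) \<le> m * exp (\<gamma> * s)" if "t \<in> {-r..s}" "s \<in> {0..t0}" for s t
  proof (cases "t \<le> 0")
    case True
    then show ?thesis using that init m by simp
  next
    case False
    then have "exp (- \<gamma> * t) * norm (x t - y t) \<le> m"
      using max[of t] that t0 by (simp add: m_def)
    then have "norm (x t - y t) \<le> m * exp (\<gamma> * t)"
      by (simp add: exp_minus field_simps)
    also have "\<dots> \<le> m * exp (\<gamma> * s)"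
      using m \<gamma> that by (intro mult_left_mono) auto
    finally show ?thesis .
  qed
  let ?h = "\<lambda>s. A (\<lambda>\<theta>. x (s + \<theta>)) - A (\<lambda>\<theta>. y (s + \<theta>))"
  have "(?h has_integral (x t0 - y t0) - (x 0 - y 0)) {0..t0}"
  proof (rule fundamental_theorem_of_calculus)
    fix s assume s: "s \<in> {0..t0}"
    then have "((\<lambda>s. x s - y s) has_vector_derivative ?h s) (at s within {0..})"
      by (intro derivative_intros der) auto
    then show "((\<lambda>s. x s - y s) has_vector_derivative ?h s) (at s within {0..t0})"
      by (rule has_vector_derivative_within_subset) auto
  qed (use t0 in auto)
  then have I: "integral {0..t0} ?h = x t0 - y t0"
    using init[of 0] r by (simp add: integral_unique)
  have "exp (- \<gamma> * t0) * norm (integral {0..t0} ?h) \<le> V * m / \<gamma>"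
  proof (rule exponential_integral_bound[OF _ _ \<gamma>])
    show "continuous_on {0..t0} ?h"
      by (intro continuous_intros continuous_on_subset[OF functional_continuous] cont) auto
    fix s assume s: "s \<in> {0..t0}"
    have "norm (?h s) \<le> V * (m * exp (\<gamma> * s))"
      using s by (intro lipschitz history_continuous cont le) auto
    then show "norm (?h s) \<le> V * m * exp (\<gamma> * s)" by simp
  qed (use t0 in auto)
  then have "m \<le> V * m / \<gamma>"
    unfolding I by (simp add: m_def)
  then have "m * \<gamma> \<le> V * m"
    using \<gamma> by (simp add: field_simps)
  then have "m = 0"
    using m by (simp add: \<gamma>_def algebra_simps)
  then have "?f T \<le> 0"
    using max[of T] T0 by (simp add: m_def)
  then show ?thesis
    by (simp add: mult_le_0_iff)
qed

end

section \<open>The equation and its adjoint\<close>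

lemma rs_integral_col_cong:
  assumes "\<And>\<theta>. \<theta> \<in> {a..b} \<Longrightarrow> f \<theta> = g \<theta>"
  shows "rs_integral_col \<eta> f a b = rs_integral_col \<eta> g a b"
proof -
  have "rs_integral (\<lambda>\<theta>. f \<theta> $ j) h a b = rs_integral (\<lambda>\<theta>. g \<theta> $ j) h a b" for j h
    by (rule rs_integral_cong) (simp add: assms)
  then show ?thesis by (simp add: rs_integral_col_def)
qed

text \<open>Through this identity the adjoint equation becomes an equation of the original type.\<close>

lemma rs_integral_row_eq_col_transpose:
  "rs_integral_row f \<eta> a b = rs_integral_col (\<lambda>\<theta>. transpose (\<eta> \<theta>)) f a b"
  by (simp add: rs_integral_row_def rs_integral_col_def transpose_def)

lemma rs_integral_row_cong:
  "(\<And>\<theta>. \<theta> \<in> {a..b} \<Longrightarrow> f \<theta> = g \<theta>) \<Longrightarrow> rs_integral_row f \<eta> a b = rs_integral_row g \<eta> a b"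
  unfolding rs_integral_row_eq_col_transpose by (rule rs_integral_col_cong)

text \<open>The constant comes from bounding the norm of a vector by the sum of the norms of its components, and
  each of these by the sum over a row of the matrix.\<close>

lemma delay_functional_rs_integral_col:
  fixes \<eta> :: "real \<Rightarrow> complex ^ 'n ^ 'n::finite"
  assumes r: "r > 0" and \<eta>: "\<And>i j. variation_dominated (\<lambda>\<theta>. \<eta> \<theta> $ i $ j) v (-r) 0"
  shows "delay_functional (\<lambda>f. rs_integral_col \<eta> f (-r) 0) r
    (real CARD('n) * (real CARD('n) * (v 0 - v (-r))))"
proof
  have has: "has_rs_integral (\<lambda>\<theta>. f \<theta> $ j) (\<lambda>\<theta>. \<eta> \<theta> $ i $ j) (-r) 0
      (rs_integral (\<lambda>\<theta>. f \<theta> $ j) (\<lambda>\<theta>. \<eta> \<theta> $ i $ j) (-r) 0)"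
    if "continuous_on {-r..0} f" for f :: "real \<Rightarrow> complex ^ 'n" and i j
    using that r by (intro has_rs_integral_cont[OF _ \<eta>] continuous_on_component) auto
  show "0 < r" by (rule r)
  show "0 \<le> real CARD('n) * (real CARD('n) * (v 0 - v (-r)))"
    using variation_dominated_mono[OF \<eta>, of "-r" 0] r by simp
  show "rs_integral_col \<eta> f (-r) 0 = rs_integral_col \<eta> g (-r) 0"
    if "\<And>\<theta>. \<theta> \<in> {-r..0} \<Longrightarrow> f \<theta> = g \<theta>" for f g
    using that by (rule rs_integral_col_cong)
  show "rs_integral_col \<eta> (\<lambda>\<theta>. f \<theta> - g \<theta>) (-r) 0 =
      rs_integral_col \<eta> f (-r) 0 - rs_integral_col \<eta> g (-r) 0"
    if f: "continuous_on {-r..0} f" and g: "continuous_on {-r..0} g" for f g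
  proof -
    have "rs_integral (\<lambda>\<theta>. (f \<theta> - g \<theta>) $ j) (\<lambda>\<theta>. \<eta> \<theta> $ i $ j) (-r) 0 =
      rs_integral (\<lambda>\<theta>. f \<theta> $ j) (\<lambda>\<theta>. \<eta> \<theta> $ i $ j) (-r) 0 -
      rs_integral (\<lambda>\<theta>. g \<theta> $ j) (\<lambda>\<theta>. \<eta> \<theta> $ i $ j) (-r) 0" for i j
      using rs_integral_eqI[OF has_rs_integral_lincomb[OF has[OF f, of j i] has[OF g, of j i],
          where c = 1 and c' = "- 1"]] by simp
    then show ?thesis
      by (simp add: rs_integral_col_def vec_eq_iff sum_subtractf)
  qed
  show "norm (rs_integral_col \<eta> f (-r) 0) \<le> real CARD('n) * (real CARD('n) * (v 0 - v (-r))) * M"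
    if f: "continuous_on {-r..0} f" and M: "\<And>\<theta>. \<theta> \<in> {-r..0} \<Longrightarrow> norm (f \<theta>) \<le> M" for f M
  proof -
    have "norm (rs_integral_col \<eta> f (-r) 0) \<le> (\<Sum>i\<in>UNIV. norm (rs_integral_col \<eta> f (-r) 0 $ i))"
      unfolding norm_vec_def by (intro L2_set_le_sum) auto
    also have "\<dots> \<le> (\<Sum>i\<in>(UNIV::'n set). \<Sum>j\<in>(UNIV::'n set). M * (v 0 - v (-r)))"
    proof (intro sum_mono)
      fix i
      have "norm (rs_integral (\<lambda>\<theta>. f \<theta> $ j) (\<lambda>\<theta>. \<eta> \<theta> $ i $ j) (-r) 0) \<le> M * (v 0 - v (-r))" for j
        using r M by (intro has_rs_integral_bound[OF has[OF f] \<eta>])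
          (auto intro: order_trans[OF Finite_Cartesian_Product.norm_nth_le])
      then show "norm (rs_integral_col \<eta> f (-r) 0 $ i) \<le> (\<Sum>j\<in>(UNIV::'n set). M * (v 0 - v (-r)))"
        unfolding rs_integral_col_def by (simp only: vec_lambda_beta) (rule sum_norm_le)
    qed
    finally show ?thesis by (simp add: mult_ac)
  qed
qed

text \<open>This passes from a total function solving the equation to its extensional restriction, which is the
  solution selected by the definite description.\<close>

lemma (in delay_functional) delay_solution_cong:
  assumes "\<And>t. t \<ge> -r \<Longrightarrow> x t = y t" and x: "delay_solution \<phi> x"
  shows "delay_solution \<phi> y"
  unfolding delay_solution_def
proof (intro conjI ballI allI impI)
  show "continuous_on {-r..} y"
    using x assms(1) continuous_on_cong[of "{-r..}" "{-r..}" x y] by (simp add: delay_solution_def)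
  show "y \<theta> = \<phi> \<theta>" if "\<theta> \<in> {-r..0}" for \<theta>
    using x assms(1)[of \<theta>] that by (simp add: delay_solution_def)
  fix t :: real assume t: "t \<ge> 0"
  have "A (\<lambda>\<theta>. y (t + \<theta>)) = A (\<lambda>\<theta>. x (t + \<theta>))"
    using t by (intro local) (simp add: assms(1))
  moreover have "(x has_vector_derivative A (\<lambda>\<theta>. x (t + \<theta>))) (at t within {0..})"
    using x t by (simp add: delay_solution_def)
  ultimately show "(y has_vector_derivative A (\<lambda>\<theta>. y (t + \<theta>))) (at t within {0..})"
    using t r assms(1) by (auto intro: has_vector_derivative_transform[where f = x])
qed

lemma (in delay_functional) delay_solution_ex1_extensional:
  assumes "continuous_on {-r..0} \<phi>"
  shows "\<exists>!x. x \<in> extensional {-r..} \<and> delay_solution \<phi> x"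
proof (rule ex_ex1I)
  obtain x where "delay_solution \<phi> x"
    using delay_solution_exists[OF assms] by blast
  then have "delay_solution \<phi> (restrict x {-r..})"
    by (rule delay_solution_cong[rotated]) simp
  then show "\<exists>x. x \<in> extensional {-r..} \<and> delay_solution \<phi> x"
    using restrict_extensional by blast
next
  fix x y assume "x \<in> extensional {-r..} \<and> delay_solution \<phi> x" "y \<in> extensional {-r..} \<and> delay_solution \<phi> y"
  then show "x = y"
    by (intro extensionalityI[of _ "{-r..}"]) (auto intro: delay_solution_unique)
qed

lemma is_solution_sol:
  fixes \<eta> :: "real \<Rightarrow> complex ^ 'n ^ 'n::finite"
  assumes r: "r > 0" and \<eta>: "\<And>i j. variation_dominated (\<lambda>\<theta>. \<eta> \<theta> $ i $ j) v (-r) 0"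
    and \<phi>: "continuous_on {-r..0} \<phi>"
  shows "is_solution r \<eta> \<phi> (sol r \<eta> \<phi>)"
proof -
  interpret delay_functional "\<lambda>f. rs_integral_col \<eta> f (-r) 0" r
      "real CARD('n) * (real CARD('n) * (v 0 - v (-r)))"
    by (rule delay_functional_rs_integral_col[OF r \<eta>])
  have "L_op r \<eta> (segment r x t) = rs_integral_col \<eta> (\<lambda>\<theta>. x (t + \<theta>)) (-r) 0" for x t
    unfolding L_op_def by (rule rs_integral_col_cong) (simp add: segment_def)
  then have "is_solution r \<eta> \<phi> x \<longleftrightarrow> x \<in> extensional {-r..} \<and> delay_solution \<phi> x" for x
    by (auto simp: is_solution_def delay_solution_def segment_def)
  then have "\<exists>!x. is_solution r \<eta> \<phi> x"
    using delay_solution_ex1_extensional[OF \<phi>] by simp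
  then show ?thesis
    unfolding sol_def by (rule theI')
qed

lemma has_vector_derivative_reflect:
  fixes y :: "real \<Rightarrow> 'a::real_normed_vector"
  shows "(y has_vector_derivative D) (at (- t) within {..0}) \<longleftrightarrow>
    ((\<lambda>s. y (- s)) has_vector_derivative - D) (at t within {0..})"
proof -
  have im: "uminus ` {0..} = {..0::real}" "uminus ` {..0} = {0::real..}"
    by simp_all
  have neg: "(uminus has_vector_derivative - 1) (at u within S)" for u :: real and S
    by (auto intro!: derivative_eq_intros)
  show ?thesis
  proof
    assume "(y has_vector_derivative D) (at (- t) within {..0})"
    then have "((y \<circ> uminus) has_vector_derivative (- 1) *\<^sub>R D) (at t within {0..})"
      by (intro vector_diff_chain_within[OF neg]) (simp add: im)
    then show "((\<lambda>s. y (- s)) has_vector_derivative - D) (at t within {0..})"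
      by (simp add: o_def)
  next
    assume "((\<lambda>s. y (- s)) has_vector_derivative - D) (at t within {0..})"
    then have "(((\<lambda>s. y (- s)) \<circ> uminus) has_vector_derivative (- 1) *\<^sub>R (- D)) (at (- t) within {..0})"
      by (intro vector_diff_chain_within[OF neg]) (simp add: im)
    then show "(y has_vector_derivative D) (at (- t) within {..0})"
      by (simp add: o_def)
  qed
qed

text \<open>Reversing time turns the adjoint equation into the delay equation of the transposed matrix function:
  \<open>t \<mapsto> y (-t)\<close> solves \<open>x'(t) = \<integral> d\<eta>\<^sup>T(\<theta>) x(t + \<theta>)\<close> with initial function \<open>\<theta> \<mapsto> \<psi> (-\<theta>)\<close>. Existence
  and uniqueness carry over.\<close>

lemma is_solution_star_sol_star:
  fixes \<eta> :: "real \<Rightarrow> complex ^ 'n ^ 'n::finite"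
  assumes r: "r > 0" and \<eta>: "\<And>i j. variation_dominated (\<lambda>\<theta>. \<eta> \<theta> $ i $ j) v (-r) 0"
    and \<psi>: "continuous_on {0..r} \<psi>"
  shows "is_solution_star r \<eta> \<psi> (sol_star r \<eta> \<psi>)"
proof -
  let ?\<eta> = "\<lambda>\<theta>. transpose (\<eta> \<theta>)"
  interpret delay_functional "\<lambda>f. rs_integral_col ?\<eta> f (-r) 0" r
      "real CARD('n) * (real CARD('n) * (v 0 - v (-r)))"
    by (rule delay_functional_rs_integral_col[OF r]) (simp add: transpose_def \<eta>)
  have cont: "continuous_on {..r} y \<longleftrightarrow> continuous_on {-r..} (\<lambda>t. y (- t))" for y :: "real \<Rightarrow> complex ^ 'n"
  proof
    assume y: "continuous_on {..r} y"
    show "continuous_on {-r..} (\<lambda>t. y (- t))"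
      by (intro continuous_on_compose2[OF y] continuous_intros) auto
  next
    assume y: "continuous_on {-r..} (\<lambda>t. y (- t))"
    have "continuous_on {..r} (\<lambda>t. y (- (- t)))"
      by (rule continuous_on_compose2[OF y, of _ uminus]) (auto intro: continuous_intros)
    then show "continuous_on {..r} y" by simp
  qed
  have Lstar: "Lstar_op r \<eta> (segment_star r y (- t)) = rs_integral_col ?\<eta> (\<lambda>\<theta>. y (- (t + \<theta>))) (-r) 0" for y t
    unfolding Lstar_op_def rs_integral_row_eq_col_transpose
    by (rule rs_integral_col_cong) (auto simp: segment_star_def algebra_simps)
  have eq: "is_solution_star r \<eta> \<psi> y \<longleftrightarrow>
      y \<in> extensional {..r} \<and> delay_solution (\<lambda>\<theta>. \<psi> (- \<theta>)) (\<lambda>t. y (- t))" for y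
  proof -
    have "(\<forall>t\<le>0. (y has_vector_derivative - Lstar_op r \<eta> (segment_star r y t)) (at t within {..0})) \<longleftrightarrow>
        (\<forall>t\<ge>0. (y has_vector_derivative - Lstar_op r \<eta> (segment_star r y (- t))) (at (- t) within {..0}))"
      by (metis neg_0_le_iff_le neg_le_0_iff_le minus_minus)
    moreover have "(\<forall>\<tau>\<in>{0..r}. segment_star r y 0 \<tau> = \<psi> \<tau>) \<longleftrightarrow> (\<forall>\<theta>\<in>{-r..0}. y (- \<theta>) = \<psi> (- \<theta>))"
    proof -
      have "{0..r} = uminus ` {-r..0}" by simp
      then show ?thesis by (simp only: ball_simps) (simp add: segment_star_def)
    qed
    ultimately show ?thesis
      unfolding is_solution_star_def delay_solution_def cont Lstar has_vector_derivative_reflect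
      by (simp add: conj_commute)
  qed
  have "continuous_on {-r..0} (\<lambda>\<theta>. \<psi> (- \<theta>))"
    by (intro continuous_on_compose2[OF \<psi>] continuous_intros) auto
  from delay_solution_ex1_extensional[OF this]
  obtain x where x: "x \<in> extensional {-r..}" "delay_solution (\<lambda>\<theta>. \<psi> (- \<theta>)) x" by blast
  have "\<exists>!y. is_solution_star r \<eta> \<psi> y"
    unfolding eq
  proof (rule ex_ex1I)
    let ?y = "\<lambda>t\<in>{..r}. x (- t)"
    have "delay_solution (\<lambda>\<theta>. \<psi> (- \<theta>)) (\<lambda>t. ?y (- t))"
      by (rule delay_solution_cong[OF _ x(2)]) simp
    then show "\<exists>y. y \<in> extensional {..r} \<and> delay_solution (\<lambda>\<theta>. \<psi> (- \<theta>)) (\<lambda>t. y (- t))"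
      by (intro exI[of _ ?y]) simp
  next
    fix y z
    assume y: "y \<in> extensional {..r} \<and> delay_solution (\<lambda>\<theta>. \<psi> (- \<theta>)) (\<lambda>t. y (- t))"
      and z: "z \<in> extensional {..r} \<and> delay_solution (\<lambda>\<theta>. \<psi> (- \<theta>)) (\<lambda>t. z (- t))"
    have "y t = z t" if "t \<le> r" for t
      using delay_solution_unique[of _ "\<lambda>t. y (- t)" "\<lambda>t. z (- t)" "- t"] y z that by auto
    with y z show "y = z"
      by (intro extensionalityI[of _ "{..r}"]) auto
  qed
  then show ?thesis
    unfolding sol_star_def by (rule theI')
qed

section \<open>Invariance of the bilinear form\<close>

text \<open>After the substitution \<open>u = s + \<xi>\<close> the integrand \<open>z (u - \<theta>) * x u\<close> no longer depends on \<open>s\<close>, which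
  enters only through the window \<open>[s + \<theta>, s]\<close>. The derivative consists of the
  values at the two end points.\<close>

lemma moving_window_derivative:
  fixes z x :: "real \<Rightarrow> complex"
  assumes z: "continuous_on UNIV z" and x: "continuous_on UNIV x"
    and \<theta>: "\<theta> \<le> 0" and s: "s \<in> {0..t}"
  shows "((\<lambda>s. integral {\<theta>..0} (\<lambda>\<xi>. z (s + (\<xi> - \<theta>)) * x (s + \<xi>))) has_vector_derivative
           z (s - \<theta>) * x s - z s * x (s + \<theta>)) (at s within {0..t})"
proof -
  let ?f = "\<lambda>u. z (u - \<theta>) * x u"
  have f: "continuous_on S ?f" for S
    by (intro continuous_intros continuous_on_compose2[OF z] continuous_on_compose2[OF x]) auto
  obtain G where G: "\<And>u. u \<in> {\<theta>..t} \<Longrightarrow> (G has_vector_derivative ?f u) (at u within {\<theta>..t})"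
    using antiderivative_continuous[OF f] by blast
  have window: "integral {\<theta>..0} (\<lambda>\<xi>. z (s + (\<xi> - \<theta>)) * x (s + \<xi>)) = G s - G (s + \<theta>)"
    if s: "s \<in> {0..t}" for s
  proof -
    have "integral {\<theta>..0} (\<lambda>\<xi>. z (s + (\<xi> - \<theta>)) * x (s + \<xi>)) = integral {\<theta>..0} (?f \<circ> (+) s)"
      by (simp add: o_def algebra_simps)
    also have "\<dots> = integral {s + \<theta>..s} ?f"
      by (simp add: integral_shift_Icc_real add.commute)
    also have "(?f has_integral G s - G (s + \<theta>)) {s + \<theta>..s}"
      using s \<theta> by (intro fundamental_theorem_of_calculus has_vector_derivative_within_subset[OF G]) auto
    then have "integral {s + \<theta>..s} ?f = G s - G (s + \<theta>)"
      by (rule integral_unique)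
    finally show ?thesis .
  qed
  have shift: "((\<lambda>s. s + \<theta>) has_vector_derivative 1) (at s within {0..t})"
    by (auto intro!: derivative_eq_intros)
  have "(G has_vector_derivative ?f s) (at s within {0..t})"
    using s \<theta> by (intro has_vector_derivative_within_subset[OF G]) auto
  moreover have "((G \<circ> (\<lambda>s. s + \<theta>)) has_vector_derivative 1 *\<^sub>R ?f (s + \<theta>)) (at s within {0..t})"
    using s \<theta> by (intro vector_diff_chain_within[OF shift] has_vector_derivative_within_subset[OF G]) auto
  ultimately have "((\<lambda>s. G s - G (s + \<theta>)) has_vector_derivative ?f s - ?f (s + \<theta>)) (at s within {0..t})"
    by (auto simp: o_def intro: has_vector_derivative_diff)
  then have "((\<lambda>s. G s - G (s + \<theta>)) has_vector_derivative z (s - \<theta>) * x s - z s * x (s + \<theta>))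
      (at s within {0..t})" by simp
  with s window show ?thesis
    by (rule has_vector_derivative_transform)
qed

lemma B_form_cong:
  assumes "r \<ge> 0" and \<psi>: "\<And>\<tau>. \<tau> \<in> {0..r} \<Longrightarrow> \<psi> \<tau> = \<psi>' \<tau>"
    and \<phi>: "\<And>\<xi>. \<xi> \<in> {-r..0} \<Longrightarrow> \<phi> \<xi> = \<phi>' \<xi>"
  shows "B_form r \<eta> \<psi> \<phi> = B_form r \<eta> \<psi>' \<phi>'"
proof -
  have "rs_integral_row (\<lambda>\<theta>. \<psi> (\<xi> - \<theta>)) \<eta> (-r) \<xi> = rs_integral_row (\<lambda>\<theta>. \<psi>' (\<xi> - \<theta>)) \<eta> (-r) \<xi>"
    if "\<xi> \<in> {-r..0}" for \<xi>
    using that by (intro rs_integral_row_cong \<psi>) auto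
  with \<phi> have "integral {-r..0} (\<lambda>\<xi>. scalar_product (rs_integral_row (\<lambda>\<theta>. \<psi> (\<xi> - \<theta>)) \<eta> (-r) \<xi>) (\<phi> \<xi>)) =
      integral {-r..0} (\<lambda>\<xi>. scalar_product (rs_integral_row (\<lambda>\<theta>. \<psi>' (\<xi> - \<theta>)) \<eta> (-r) \<xi>) (\<phi>' \<xi>))"
    by (intro integral_cong) simp
  then show ?thesis
    using assms(1) \<psi>[of 0] \<phi>[of 0] by (simp add: B_form_def)
qed

text \<open>With the order of integration exchanged, the integrals against \<open>d\<eta>\<close> run over the fixed
  interval \<open>[-r, 0]\<close>, so that \<open>has_vector_derivative_rs_integral\<close> applies to them.\<close>

lemma B_form_exchange:
  fixes \<eta> :: "real \<Rightarrow> complex ^ 'n ^ 'n::finite"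
  assumes r: "r > 0" and \<eta>: "\<And>i j. variation_dominated (\<lambda>\<theta>. \<eta> \<theta> $ i $ j) v (-r) 0"
    and \<psi>: "continuous_on {0..r} \<psi>" and \<phi>: "continuous_on {-r..0} \<phi>"
  obtains R where
    "\<And>i j. has_rs_integral (\<lambda>\<theta>. integral {\<theta>..0} (\<lambda>\<xi>. \<psi> (\<xi> - \<theta>) $ i * \<phi> \<xi> $ j))
       (\<lambda>\<theta>. \<eta> \<theta> $ i $ j) (-r) 0 (R i j)"
    "B_form r \<eta> \<psi> \<phi> = (\<Sum>i\<in>UNIV. \<psi> 0 $ i * \<phi> 0 $ i) + (\<Sum>j\<in>UNIV. \<Sum>i\<in>UNIV. R i j)"
proof -
  let ?J = "\<lambda>i j \<xi>. rs_integral (\<lambda>\<theta>. \<psi> (\<xi> - \<theta>) $ i) (\<lambda>\<theta>. \<eta> \<theta> $ i $ j) (-r) \<xi> * \<phi> \<xi> $ j"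
  have \<psi>i: "continuous_on {0..0 - (-r)} (\<lambda>u. \<psi> u $ i)" for i
    using \<psi> by (auto intro: continuous_on_component)
  have \<phi>j: "continuous_on {-r..0} (\<lambda>u. \<phi> u $ j)" for j
    using \<phi> by (rule continuous_on_component)
  have r': "-r \<le> 0" using r by simp
  note exch = convolution_exchange[OF \<psi>i \<phi>j \<eta> r']
  have int: "(\<lambda>\<xi>. \<Sum>i\<in>UNIV. ?J i j \<xi>) integrable_on {-r..0}" for j
    by (intro integrable_sum exch) auto
  have "integral {-r..0} (\<lambda>\<xi>. scalar_product (rs_integral_row (\<lambda>\<theta>. \<psi> (\<xi> - \<theta>)) \<eta> (-r) \<xi>) (\<phi> \<xi>)) =
      integral {-r..0} (\<lambda>\<xi>. \<Sum>j\<in>UNIV. \<Sum>i\<in>UNIV. ?J i j \<xi>)"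
    by (simp add: scalar_product_def rs_integral_row_def sum_distrib_right)
  also have "\<dots> = (\<Sum>j\<in>UNIV. \<Sum>i\<in>UNIV. integral {-r..0} (?J i j))"
    by (simp add: integral_sum int exch(1))
  finally show thesis
    by (intro that[of "\<lambda>i j. integral {-r..0} (?J i j)"])
       (simp_all add: exch(2) B_form_def scalar_product_def)
qed

text \<open>In the derivative of the form at the shifted pair, the product \<open>Z(s) X(s)\<close> contributes
  \<open>Z(s) \<integral> d\<eta>(\<theta>) X(s + \<theta>) - (\<integral> Z(s - \<theta>) d\<eta>(\<theta>)) X(s)\<close>, and the integral part contributes
  \<open>\<integral> Z(s - \<theta>) d\<eta>(\<theta>) X(s) - Z(s) \<integral> d\<eta>(\<theta>) X(s + \<theta>)\<close>; the sum is zero.\<close>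

lemma B_form_invariant_along_trajectories:
  fixes \<eta> :: "real \<Rightarrow> complex ^ 'n ^ 'n::finite"
  assumes r: "r > 0" and \<eta>: "\<And>i j. variation_dominated (\<lambda>\<theta>. \<eta> \<theta> $ i $ j) v (-r) 0"
    and Z: "continuous_on UNIV Z" and X: "continuous_on UNIV X"
    and dZ: "\<And>s. s \<in> {0..t} \<Longrightarrow> (Z has_vector_derivative
               - rs_integral_row (\<lambda>\<theta>. Z (s - \<theta>)) \<eta> (-r) 0) (at s within {0..t})"
    and dX: "\<And>s. s \<in> {0..t} \<Longrightarrow> (X has_vector_derivative
               rs_integral_col \<eta> (\<lambda>\<theta>. X (s + \<theta>)) (-r) 0) (at s within {0..t})"
    and t: "t \<ge> 0"
  shows "B_form r \<eta> (\<lambda>\<tau>. Z (t + \<tau>)) (\<lambda>\<xi>. X (t + \<xi>)) = B_form r \<eta> Z X"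
proof -
  have Zs: "continuous_on S (\<lambda>u. Z (f u) $ i)" if "continuous_on S f" for S i and f :: "'a::topological_space \<Rightarrow> real"
    by (intro continuous_on_component continuous_on_compose2[OF Z that]) auto
  have Xs: "continuous_on S (\<lambda>u. X (f u) $ i)" if "continuous_on S f" for S i and f :: "'a::topological_space \<Rightarrow> real"
    by (intro continuous_on_component continuous_on_compose2[OF X that]) auto
  have r': "-r \<le> 0" using r by simp
  let ?B = "\<lambda>s. B_form r \<eta> (\<lambda>\<tau>. Z (s + \<tau>)) (\<lambda>\<xi>. X (s + \<xi>))"
  have "\<exists>R. \<forall>s. (\<forall>i j. has_rs_integral (\<lambda>\<theta>. integral {\<theta>..0} (\<lambda>\<xi>. Z (s + (\<xi> - \<theta>)) $ i * X (s + \<xi>) $ j))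
       (\<lambda>\<theta>. \<eta> \<theta> $ i $ j) (-r) 0 (R s i j)) \<and>
    ?B s = (\<Sum>i\<in>UNIV. Z s $ i * X s $ i) + (\<Sum>j\<in>UNIV. \<Sum>i\<in>UNIV. R s i j)"
  proof (rule choice, rule allI)
    fix s
    have "continuous_on {0..r} (\<lambda>\<tau>. Z (s + \<tau>))" "continuous_on {-r..0} (\<lambda>\<xi>. X (s + \<xi>))"
      by (auto intro!: continuous_on_compose2[OF Z] continuous_on_compose2[OF X] continuous_intros)
    from B_form_exchange[OF r \<eta> this] obtain R where
      "\<And>i j. has_rs_integral (\<lambda>\<theta>. integral {\<theta>..0} (\<lambda>\<xi>. Z (s + (\<xi> - \<theta>)) $ i * X (s + \<xi>) $ j))
         (\<lambda>\<theta>. \<eta> \<theta> $ i $ j) (-r) 0 (R i j)"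
      "?B s = (\<Sum>i\<in>UNIV. Z (s + 0) $ i * X (s + 0) $ i) + (\<Sum>j\<in>UNIV. \<Sum>i\<in>UNIV. R i j)" by blast
    then show "\<exists>R. (\<forall>i j. has_rs_integral (\<lambda>\<theta>. integral {\<theta>..0} (\<lambda>\<xi>. Z (s + (\<xi> - \<theta>)) $ i * X (s + \<xi>) $ j))
         (\<lambda>\<theta>. \<eta> \<theta> $ i $ j) (-r) 0 (R i j)) \<and>
      ?B s = (\<Sum>i\<in>UNIV. Z s $ i * X s $ i) + (\<Sum>j\<in>UNIV. \<Sum>i\<in>UNIV. R i j)" by auto
  qed
  then obtain R where R: "\<And>s i j. has_rs_integral
        (\<lambda>\<theta>. integral {\<theta>..0} (\<lambda>\<xi>. Z (s + (\<xi> - \<theta>)) $ i * X (s + \<xi>) $ j)) (\<lambda>\<theta>. \<eta> \<theta> $ i $ j) (-r) 0 (R s i j)"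
    and B: "\<And>s. ?B s = (\<Sum>i\<in>UNIV. Z s $ i * X s $ i) + (\<Sum>j\<in>UNIV. \<Sum>i\<in>UNIV. R s i j)"
    by blast
  define P where "P i j s = rs_integral (\<lambda>\<theta>. Z (s - \<theta>) $ i) (\<lambda>\<theta>. \<eta> \<theta> $ i $ j) (-r) 0" for i j s
  define S where "S i j s = rs_integral (\<lambda>\<theta>. X (s + \<theta>) $ j) (\<lambda>\<theta>. \<eta> \<theta> $ i $ j) (-r) 0" for i j s
  have dR: "((\<lambda>s. R s i j) has_vector_derivative X s $ j * P i j s - Z s $ i * S i j s) (at s within {0..t})"
    if s: "s \<in> {0..t}" for s i j
  proof -
    let ?Q = "\<lambda>s \<theta>. Z (s - \<theta>) $ i * X s $ j - Z s $ i * X (s + \<theta>) $ j"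
    have "((\<lambda>s. R s i j) has_vector_derivative rs_integral (?Q s) (\<lambda>\<theta>. \<eta> \<theta> $ i $ j) (-r) 0) (at s within {0..t})"
    proof (rule has_vector_derivative_rs_integral[OF R _ _ \<eta> r' s])
      fix \<theta> s assume "\<theta> \<in> {-r..0}" "s \<in> {0..t}"
      then show "((\<lambda>s. integral {\<theta>..0} (\<lambda>\<xi>. Z (s + (\<xi> - \<theta>)) $ i * X (s + \<xi>) $ j)) has_vector_derivative ?Q s \<theta>)
          (at s within {0..t})"
        using Zs[of UNIV "\<lambda>u. u"] Xs[of UNIV "\<lambda>u. u"]
        by (intro moving_window_derivative[of "\<lambda>u. Z u $ i" "\<lambda>u. X u $ j"]) auto
    next
      show "continuous_on ({0..t} \<times> {-r..0}) (\<lambda>(s, \<theta>). ?Q s \<theta>)"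
        unfolding case_prod_unfold by (intro continuous_intros Zs Xs)
    qed
    moreover have "has_rs_integral (\<lambda>\<theta>. X s $ j * Z (s - \<theta>) $ i + (- Z s $ i) * X (s + \<theta>) $ j)
        (\<lambda>\<theta>. \<eta> \<theta> $ i $ j) (-r) 0 (X s $ j * P i j s + (- Z s $ i) * S i j s)"
      unfolding P_def S_def
      by (intro has_rs_integral_lincomb has_rs_integral_cont[OF _ \<eta> r'] Zs Xs continuous_intros)
    then have "rs_integral (?Q s) (\<lambda>\<theta>. \<eta> \<theta> $ i $ j) (-r) 0 = X s $ j * P i j s - Z s $ i * S i j s"
      by (intro rs_integral_eqI) (simp add: algebra_simps)
    ultimately show ?thesis by simp
  qed
  have nth: "bounded_linear (\<lambda>x::complex ^ 'n. x $ i)" for i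
    by (rule bounded_linear_vec_nth)
  have dXi: "((\<lambda>s. X s $ i) has_vector_derivative (\<Sum>j\<in>UNIV. S i j s)) (at s within {0..t})"
    if "s \<in> {0..t}" for s i
    using bounded_linear.has_vector_derivative[OF nth dX[OF that], of i]
    by (simp add: rs_integral_col_def S_def)
  have dZi: "((\<lambda>s. Z s $ j) has_vector_derivative - (\<Sum>i\<in>UNIV. P i j s)) (at s within {0..t})"
    if "s \<in> {0..t}" for s j
    using bounded_linear.has_vector_derivative[OF nth dZ[OF that], of j]
    by (simp add: rs_integral_row_def P_def)
  have "(?B has_vector_derivative 0) (at s within {0..t})" if s: "s \<in> {0..t}" for s
  proof -
    have "(?B has_vector_derivative
        (\<Sum>i\<in>UNIV. Z s $ i * (\<Sum>j\<in>UNIV. S i j s) + - (\<Sum>k\<in>UNIV. P k i s) * X s $ i) +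
        (\<Sum>j\<in>UNIV. \<Sum>i\<in>UNIV. X s $ j * P i j s - Z s $ i * S i j s)) (at s within {0..t})"
      unfolding B by (intro has_vector_derivative_add has_vector_derivative_sum
          has_vector_derivative_mult dXi dZi dR s)
    also have "(\<Sum>i\<in>UNIV. Z s $ i * (\<Sum>j\<in>UNIV. S i j s) + - (\<Sum>k\<in>UNIV. P k i s) * X s $ i) =
        (\<Sum>i\<in>UNIV. \<Sum>j\<in>UNIV. Z s $ i * S i j s) - (\<Sum>j\<in>UNIV. \<Sum>i\<in>UNIV. X s $ j * P i j s)"
      by (simp add: sum_distrib_left sum_subtractf mult.commute[of "X s $ _"] sum_distrib_right)
    also have "\<dots> + (\<Sum>j\<in>UNIV. \<Sum>i\<in>UNIV. X s $ j * P i j s - Z s $ i * S i j s) = 0"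
      by (simp add: sum_subtractf sum.swap[of "\<lambda>i j. Z s $ i * S i j s"])
    finally show ?thesis .
  qed
  then have "?B t = ?B 0"
    using t by (intro Derivative.has_derivative_zero_unique[of "{0..t}" ?B])
      (auto simp: has_vector_derivative_def)
  then show ?thesis by simp
qed

theorem theorem3p2:
  fixes r :: real and \<eta> :: "real \<Rightarrow> complex ^ 'n ^ 'n::finite"
  assumes "r > 0"
    and "bounded_variation_on \<eta> (-r) 0"
  shows "\<forall>(\<psi>, \<phi>) \<in> Cstar_space r \<times> C_space r. \<forall>t\<ge>0.
           B_form r \<eta> \<psi> (T_op r \<eta> t \<phi>) = B_form r \<eta> (Tstar_op r \<eta> t \<psi>) \<phi>"
proof (clarify)
  fix \<psi> \<phi> :: "real \<Rightarrow> complex ^ 'n" and t :: real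
  assume "\<psi> \<in> Cstar_space r" "\<phi> \<in> C_space r" and t: "0 \<le> t"
  then have \<psi>: "continuous_on {0..r} \<psi>" and \<phi>: "continuous_on {-r..0} \<phi>"
    by (auto simp: Cstar_space_def C_space_def)
  obtain v where "variation_dominated \<eta> v (-r) 0"
    using bounded_variation_dominated[OF assms(2)] .
  then have \<eta>: "variation_dominated (\<lambda>\<theta>. \<eta> \<theta> $ i $ j) v (-r) 0" for i j
    by (intro variation_dominated_nth)
  define x where "x = sol r \<eta> \<phi>"
  define y where "y = sol_star r \<eta> \<psi>"
  have x: "is_solution r \<eta> \<phi> x"
    unfolding x_def by (rule is_solution_sol[OF assms(1) \<eta> \<phi>])
  have y: "is_solution_star r \<eta> \<psi> y"
    unfolding y_def by (rule is_solution_star_sol_star[OF assms(1) \<eta> \<psi>])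
  \<comment> \<open>The constant continuations to the whole line have the same segments and need no domain
    conditions; \<open>Z\<close> is in addition shifted so that both trajectories live on \<open>[0, t]\<close>.\<close>
  define X where "X u = x (max (-r) u)" for u
  define Z where "Z u = y (min r (u - t))" for u
  have cont: "continuous_on {-r..} x" "continuous_on {..r} y"
    using x y by (simp_all add: is_solution_def is_solution_star_def)
  have X: "continuous_on UNIV X"
    unfolding X_def by (intro continuous_on_compose2[OF cont(1)] continuous_intros) auto
  have Z: "continuous_on UNIV Z"
    unfolding Z_def by (intro continuous_on_compose2[OF cont(2)] continuous_intros) auto
  have Xx: "X u = x u" if "u \<ge> -r" for u
    using that by (simp add: X_def)
  have Zy: "Z u = y (u - t)" if "u - t \<le> r" for u
    using that by (simp add: Z_def)
  have "B_form r \<eta> (\<lambda>\<tau>. Z (t + \<tau>)) (\<lambda>\<xi>. X (t + \<xi>)) = B_form r \<eta> Z X"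
  proof (rule B_form_invariant_along_trajectories[OF assms(1) \<eta> Z X _ _ t])
    fix s assume s: "s \<in> {0..t}"
    have "(x has_vector_derivative L_op r \<eta> (segment r x s)) (at s within {0..})"
      using x s by (simp add: is_solution_def)
    then have "(x has_vector_derivative L_op r \<eta> (segment r x s)) (at s within {0..t})"
      by (rule has_vector_derivative_within_subset) auto
    moreover have "L_op r \<eta> (segment r x s) = rs_integral_col \<eta> (\<lambda>\<theta>. X (s + \<theta>)) (-r) 0"
      unfolding L_op_def using s by (intro rs_integral_col_cong) (simp add: segment_def Xx)
    ultimately show "(X has_vector_derivative rs_integral_col \<eta> (\<lambda>\<theta>. X (s + \<theta>)) (-r) 0) (at s within {0..t})"
      using s assms(1) by (auto intro!: has_vector_derivative_transform[of s "{0..t}" X x] simp: Xx)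
    have "(y has_vector_derivative - Lstar_op r \<eta> (segment_star r y (s - t))) (at (s - t) within {..0})"
      using y s by (simp add: is_solution_star_def)
    then have "(y has_vector_derivative - Lstar_op r \<eta> (segment_star r y (s - t)))
        (at (s - t) within (\<lambda>s. s - t) ` {0..t})"
      by (rule has_vector_derivative_within_subset) auto
    moreover have "((\<lambda>s. s - t) has_vector_derivative 1) (at s within {0..t})"
      by (auto intro!: derivative_eq_intros)
    ultimately have "((y \<circ> (\<lambda>s. s - t)) has_vector_derivative
        1 *\<^sub>R (- Lstar_op r \<eta> (segment_star r y (s - t)))) (at s within {0..t})"
      by (intro vector_diff_chain_within)
    moreover have "Lstar_op r \<eta> (segment_star r y (s - t)) = rs_integral_row (\<lambda>\<theta>. Z (s - \<theta>)) \<eta> (-r) 0"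
      unfolding Lstar_op_def using s
      by (intro rs_integral_row_cong) (auto simp: segment_star_def Zy algebra_simps)
    ultimately show "(Z has_vector_derivative - rs_integral_row (\<lambda>\<theta>. Z (s - \<theta>)) \<eta> (-r) 0) (at s within {0..t})"
      using s assms(1)
      by (auto intro!: has_vector_derivative_transform[of s "{0..t}" Z "y \<circ> (\<lambda>s. s - t)"] simp: Zy)
  qed
  moreover have "B_form r \<eta> \<psi> (T_op r \<eta> t \<phi>) = B_form r \<eta> (\<lambda>\<tau>. Z (t + \<tau>)) (\<lambda>\<xi>. X (t + \<xi>))"
    using assms(1) t y
    by (intro B_form_cong)
       (auto simp: T_op_def x_def[symmetric] segment_def Xx Zy is_solution_star_def segment_star_def)
  moreover have "B_form r \<eta> (Tstar_op r \<eta> t \<psi>) \<phi> = B_form r \<eta> Z X"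
    using assms(1) t x
    by (intro B_form_cong)
       (auto simp: Tstar_op_def y_def[symmetric] segment_star_def Xx Zy is_solution_def segment_def)
  ultimately show "B_form r \<eta> \<psi> (T_op r \<eta> t \<phi>) = B_form r \<eta> (Tstar_op r \<eta> t \<psi>) \<phi>"
    by simp
qed

end
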